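(* Let $k\ge0$, $k\neq1$, and let $A=RB:I\to\mathbb{R}^{3\times6}$ be smooth on an open interval $I$, with $R(t)\in SO(3)$, $$B=\begin{pmatrix}b_{11}&b_{12}&\ell_1b_{11}+\ell_2b_{12}&-\ell_2b_{11}+\ell_1b_{12}&\ell_1b_{15}&-\ell_2b_{15}\\0&b_{22}&\ell_2b_{22}&\ell_1b_{22}&\ell_1b_{25}&-\ell_2b_{25}\\0&0&0&0&\ell_1b_{35}&-\ell_2b_{35}\end{pmatrix},$$ $$b_{11}b_{22}b_{35}(\ell_1^2+\ell_2^2)+1=0,\qquad \ell_1=k+\cos\theta,\quad \ell_2=\sin\theta,\qquad \theta'b_{11}b_{22}=\gamma,$$ where $\gamma\ne0$ is a constant. Suppose that $Q_{12},Q_{13},Q_{14},Q_{23},Q_{24},Q_{35},Q_{36},Q_{45},Q_{46},Q_{56}$ are constant, $Q_{ij}=c_{ij}$, that $Q_{15}-Q_{26}$ and $Q_{16}+Q_{25}$ are constant, and that $c_{12}\neq0$. Then $b_{15}=b_{25}=0$ and $$(\theta')^3=\frac{\gamma^2c_{56}\,(k^2+2k\cos\theta+1)^2}{k\cos\theta+1},\qquad b_{35}=-\frac{\theta'}{\gamma\,(k^2+2k\cos\theta+1)},$$ $$b_{11}^2=\frac{(c_{14}-c_{12}k)\cos\theta+c_{13}\sin\theta-c_{12}}{\theta'},\qquad b_{12}=\frac{(c_{14}-c_{12}k)\sin\theta-c_{13}\cos\theta}{b_{11}\theta'},$$ $$b_{22}=\frac{\gamma}{b_{11}\theta'},\qquad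 w_1=w_2=0,\qquad w_3=-\frac{\gamma}{b_{11}^2}.$$ Conversely, functions defined by these formulas on an interval where they make sense (with constants satisfying $\gamma^2=c_{12}^2-(c_{12}k-c_{14})^2-c_{13}^2$, $c_{56}\ne0$), together with $b_{15}=b_{25}=0$, satisfy all the conditions imposed on $A=RB$ in this statement: $b_{11}b_{22}b_{35}(\ell_1^2+\ell_2^2)+1=0$ and $\theta'b_{11}b_{22}=\gamma$ with $\ell_1=k+\cos\theta$, $\ell_2=\sin\theta$, the constancy $Q_{ij}=c_{ij}$ of $Q_{12},Q_{13},Q_{14},Q_{23},Q_{24},Q_{35},Q_{36},Q_{45},Q_{46},Q_{56}$, the constancy of $Q_{15}-Q_{26}$ and $Q_{16}+Q_{25}$, and $c_{12}\neq0$.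
   Context: For $A(t)\in\mathbb{R}^{3\times m}$ with columns $A_i$, $Q_{ij}=\langle A_i',A_j\rangle-\langle A_j',A_i\rangle$, $'=d/dt$. For smooth $R(t)\in SO(3)$ the vector $w=(w_1,w_2,w_3)$ is defined by $R^TR'x=\tfrac12\,w\times x$ for all $x\in\mathbb{R}^3$. Origin: $\varphi(z,t)=A(t)v(z)$ is sought as a solution of the 3D incompressible Euler equations in Lagrangian form with $v=(z_1,z_2,z_3,f^1(z_3),f^2(z_1,z_2),f^3(z_1,z_2))$, where $\partial_{z_1}f^2+\partial_{z_2}f^3=0$, $\partial_{z_2}f^2-\partial_{z_1}f^3=0$ (elliptic case, $m=6$). The form $$B=\begin{pmatrix}b_{11}&b_{12}&\ell_1b_{11}+\ell_2b_{12}&-\ell_2b_{11}+\ell_1b_{12}&\ell_1b_{15}&-\ell_2b_{15}\\0&b_{22}&\ell_2b_{22}&\ell_1b_{22}&\ell_1b_{25}&-\ell_2b_{25}\\0&0&0&0&\ell_1b_{35}&-\ell_2b_{35}\end{pmatrix},\qquad b_{11}b_{22}b_{35}(\ell_1^2+\ell_2^2)+1=0,$$ is the one for which the minors $p_{ijk}=\det(A_i,A_j,A_k)$ satisfy $p_{123}=p_{356}=p_{124}=p_{456}=0$, $p_{135}-p_{236}=p_{146}+p_{245}=0$, $p_{136}+p_{235}=-p_{145}+p_{246}=1$. The form of $\ell_1,\ell_2$ (circle of radius 1 centered at $(k,0)$) and the relation $\theta'b_{11}b_{22}=\gamma$, with $\gamma^2=c_{12}^2-(c_{12}k-c_{14})^2-c_{13}^2$,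 are the normalized form ($k_0=1$, $k_1=k$, $k_2=0$) of the following fact: the constancy of $Q_{12},Q_{13},Q_{14},Q_{23},Q_{24}$ yields a function $\theta$ and constants $k_0,k_1,k_2,\gamma$ with $\ell_1=k_1+k_0\cos\theta$, $\ell_2=k_2+k_0\sin\theta$, $\theta'b_{11}b_{22}=\gamma$, $\gamma^2=c_{12}^2k_0^2-(c_{12}k_1-c_{14})^2-(c_{12}k_2-c_{13})^2$. *)

theory Defs
  imports "HOL-Analysis.Analysis"
begin

(* Smoothness on an open set: D n is the n-th derivative of f on S. *)
definition smooth_on :: "real set \<Rightarrow> (real \<Rightarrow> 'a::real_normed_vector) \<Rightarrow> bool" where
  "smooth_on S f \<longleftrightarrow>
     (\<exists>D :: nat \<Rightarrow> real \<Rightarrow> 'a. D 0 = f \<and>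
        (\<forall>n. \<forall>t\<in>S. (D n has_vector_derivative D (Suc n) t) (at t)))"

definition Qform :: "(real \<Rightarrow> real^'m^3) \<Rightarrow> 'm \<Rightarrow> 'm \<Rightarrow> real \<Rightarrow> real" where
  "Qform A i j t =
     vector_derivative (\<lambda>s. column i (A s)) (at t) \<bullet> column j (A t)
     - vector_derivative (\<lambda>s. column j (A s)) (at t) \<bullet> column i (A t)"

(* The factor 1/2 is part of the convention for w: it is twice the usual angular
   velocity in the body frame. *)
definition has_rotation_vector :: "(real \<Rightarrow> real^3^3) \<Rightarrow> real^3 \<Rightarrow> real \<Rightarrow> bool" where
  "has_rotation_vector R w t \<longleftrightarrow>
     (\<exists>R'. (R has_vector_derivative R') (at t) \<and>
        (\<forall>x. (transpose (R t) ** R') *v x = (1/2) *\<^sub>R cross3 w x))"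

definition Bmat ::
  "real \<Rightarrow> real \<Rightarrow> real \<Rightarrow> real \<Rightarrow> real \<Rightarrow> real \<Rightarrow> real \<Rightarrow> real \<Rightarrow> real^6^3" where
  "Bmat l1 l2 b11 b12 b22 b15 b25 b35 = vector
     [vector [b11, b12, l1 * b11 + l2 * b12, - l2 * b11 + l1 * b12, l1 * b15, - l2 * b15],
      vector [0,   b22, l2 * b22,            l1 * b22,              l1 * b25, - l2 * b25],
      vector [0,   0,   0,                   0,                     l1 * b35, - l2 * b35]]"

(* The conditions imposed on A = R B, apart from R(t) being a rotation and the shape of B. *)
definition admissible ::
  "real set \<Rightarrow> real \<Rightarrow> (6 \<Rightarrow> 6 \<Rightarrow> real) \<Rightarrow> (real \<Rightarrow> real^3^3) \<Rightarrow> (real \<Rightarrow> real^6^3)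
   \<Rightarrow> (real \<Rightarrow> real) \<Rightarrow> (real \<Rightarrow> real) \<Rightarrow> (real \<Rightarrow> real)
   \<Rightarrow> (real \<Rightarrow> real) \<Rightarrow> (real \<Rightarrow> real) \<Rightarrow> (real \<Rightarrow> real) \<Rightarrow> bool" where
  "admissible I \<gamma> c R A \<theta> l1 l2 b11 b22 b35 \<longleftrightarrow>
     smooth_on I R \<and> smooth_on I A \<and> \<theta> differentiable_on I \<and>
     (\<forall>t\<in>I. b11 t * b22 t * b35 t * ((l1 t)\<^sup>2 + (l2 t)\<^sup>2) + 1 = 0) \<and>
     (\<forall>t\<in>I. deriv \<theta> t * b11 t * b22 t = \<gamma>) \<and>
     (\<forall>(i, j) \<in> {(1,2), (1,3), (1,4), (2,3), (2,4), (3,5), (3,6), (4,5), (4,6), (5,6)}.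
        \<forall>t\<in>I. Qform A i j t = c i j) \<and>
     (\<exists>d. \<forall>t\<in>I. Qform A 1 5 t - Qform A 2 6 t = d) \<and>
     (\<exists>d. \<forall>t\<in>I. Qform A 1 6 t + Qform A 2 5 t = d) \<and>
     c 1 2 \<noteq> 0"

(* The explicit formulas; the first line says that all their denominators are nonzero. *)
definition explicit_formulas ::
  "real set \<Rightarrow> real \<Rightarrow> real \<Rightarrow> real \<Rightarrow> real \<Rightarrow> real \<Rightarrow> real \<Rightarrow> (real \<Rightarrow> real)
   \<Rightarrow> (real \<Rightarrow> real) \<Rightarrow> (real \<Rightarrow> real) \<Rightarrow> (real \<Rightarrow> real)
   \<Rightarrow> (real \<Rightarrow> real) \<Rightarrow> (real \<Rightarrow> real) \<Rightarrow> (real \<Rightarrow> real) \<Rightarrow> (real \<Rightarrow> real^3) \<Rightarrow> bool" where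
  "explicit_formulas I k \<gamma> c12 c13 c14 c56 \<theta> b11 b12 b22 b15 b25 b35 w \<longleftrightarrow>
     (\<forall>t\<in>I.
        k * cos (\<theta> t) + 1 \<noteq> 0 \<and> k\<^sup>2 + 2 * k * cos (\<theta> t) + 1 \<noteq> 0 \<and> deriv \<theta> t \<noteq> 0 \<and> b11 t \<noteq> 0 \<and>
        b15 t = 0 \<and> b25 t = 0 \<and>
        (deriv \<theta> t)^3 = \<gamma>\<^sup>2 * c56 * (k\<^sup>2 + 2 * k * cos (\<theta> t) + 1)\<^sup>2 / (k * cos (\<theta> t) + 1) \<and>
        b35 t = - (deriv \<theta> t / (\<gamma> * (k\<^sup>2 + 2 * k * cos (\<theta> t) + 1))) \<and>
        (b11 t)\<^sup>2 = ((c14 - c12 * k) * cos (\<theta> t) + c13 * sin (\<theta> t) - c12) / deriv \<theta> t \<and>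
        b12 t = ((c14 - c12 * k) * sin (\<theta> t) - c13 * cos (\<theta> t)) / (b11 t * deriv \<theta> t) \<and>
        b22 t = \<gamma> / (b11 t * deriv \<theta> t) \<and>
        w t $ 1 = 0 \<and> w t $ 2 = 0 \<and> w t $ 3 = - (\<gamma> / (b11 t)\<^sup>2))"

end

theory Submission
  imports Defs "HOL-Computational_Algebra.Polynomial"
begin

text \<open>
  Write \<open>X, Y\<close> for the first two columns of \<open>B\<close> and \<open>Z = (b15, b25, b35)\<close>. The remaining columns are
  \<open>l1 X + l2 Y\<close>, \<open>- l2 X + l1 Y\<close>, \<open>l1 Z\<close> and \<open>- l2 Z\<close>, and in the frame rotating with \<open>R\<close> the bracket of
  two columns \<open>V, W\<close> is \<open>w \<bullet> (V \<times> W) + V' \<bullet> W - W' \<bullet> V\<close>. A bracket of multiples \<open>f V\<close>, \<open>g W\<close> is \<open>f g\<close>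
  times the bracket of \<open>V, W\<close> plus \<open>(f' g - f g') (V \<bullet> W)\<close>, so every condition turns into a linear
  relation between the three brackets and the inner products of \<open>X, Y, Z\<close>, with coefficients that are
  trigonometric polynomials in \<open>\<theta>\<close> times powers of \<open>\<tau> = \<theta>'\<close>. The proof then splits into two
  independent problems.

  The conditions on the columns 1 to 4 concern \<open>X\<close> and \<open>Y\<close> only. They are solved by rotating the
  equations by the angle \<open>\<theta>\<close> and give \<open>\<tau>\<close> times the Gram matrix of \<open>X, Y\<close> as explicit functions of
  \<open>\<theta>\<close> (\<open>gram_from_Q13_Q14\<close>, \<open>gram_from_Q23_Q24\<close>); its determinant is \<open>\<gamma>\<^sup>2\<close>, which gives the relation
  between \<open>\<gamma>\<close> and the constants. Since \<open>b12 / b11\<close> is a quotient of Gram entries, the Wronskian of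
  \<open>b11, b12\<close> is known as well (\<open>wronskian_from_gram\<close>), and the first bracket determines \<open>w\<^sub>3\<close>.

  The conditions that mix \<open>X, Y\<close> with \<open>Z\<close> involve six constants. In complex notation, after
  eliminating the unknown functions, they become a single identity: a cubic polynomial in \<open>e\<^sup>i\<^sup>\<theta>\<close>
  with constant coefficients vanishes along the motion (\<open>cubic_in_cis\<close>). Because \<open>\<theta>\<close> really moves, all
  coefficients vanish, and for \<open>k\<^sup>2 \<noteq> 1\<close> this forces all six constants to be zero. Hence \<open>X, Y\<close> have
  zero inner product and zero bracket with \<open>Z\<close> (\<open>third_column_decouples\<close>), which says
  \<open>b15 = b25 = 0\<close> and \<open>w\<^sub>1 = w\<^sub>2 = 0\<close>. The last bracket is \<open>\<tau> (1 + k cos \<theta>) \<bar>Z\<bar>\<^sup>2\<close> and gives the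
  equation for \<open>\<tau>\<^sup>3\<close>.

  For the converse the same identities are read backwards. What is new is smoothness: \<open>\<theta>\<close> solves
  \<open>\<theta>'\<^sup>3 = F(\<theta>)\<close> with \<open>F \<noteq> 0\<close> smooth, so each derivative gained for \<open>\<theta>\<close> gives one for \<open>\<theta>'\<close>; the function
  \<open>b11\<close> is a continuous non-vanishing square root of a smooth function, and \<open>R\<close> solves a linear
  differential equation with smooth coefficients.
\<close>

section \<open>Calculus of vector- and matrix-valued functions\<close>

lemma bounded_bilinear_matrix_mult:
  "bounded_bilinear ((**) :: real^'n^'m \<Rightarrow> real^'p^'n \<Rightarrow> real^'p^'m)"
  unfolding bilinear_conv_bounded_bilinear[symmetric] bilinear_def
  by (auto intro!: linearI
      simp: matrix_matrix_mult_def vec_eq_iff sum.distrib sum_distrib_left algebra_simps)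

text \<open>Convergence of the difference quotients can be tested on coordinates.\<close>
lemma has_vector_derivative_vec:
  fixes f :: "real \<Rightarrow> ('a::real_normed_vector)^'n"
  assumes "\<And>i. ((\<lambda>s. f s $ i) has_vector_derivative f' $ i) (at t)"
  shows "(f has_vector_derivative f') (at t)"
proof -
  have "((\<lambda>y. (f y - f t - (y - t) *\<^sub>R f') /\<^sub>R norm (y - t)) \<longlongrightarrow> 0) (at t)"
    using assms unfolding has_vector_derivative_def has_derivative_def
    by (intro vec_tendstoI) auto
  then show ?thesis
    unfolding has_vector_derivative_def has_derivative_def
    by (simp add: bounded_linear_scaleR_left)
qed

lemma has_vector_derivative_vec_nth:
  assumes "(f has_vector_derivative f') (at t)"
  shows "((\<lambda>s. f s $ i) has_vector_derivative f' $ i) (at t)"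
  using bounded_linear.has_vector_derivative[OF bounded_linear_vec_nth assms] .

lemma has_vector_derivative_vector_3:
  fixes f g h :: "real \<Rightarrow> real"
  assumes "(f has_real_derivative f') (at t)" "(g has_real_derivative g') (at t)" "(h has_real_derivative h') (at t)"
  shows "((\<lambda>s. vector [f s, g s, h s] :: real^3) has_vector_derivative vector [f', g', h']) (at t)"
proof (rule has_vector_derivative_vec)
  fix i :: 3
  show "((\<lambda>s. (vector [f s, g s, h s] :: real^3) $ i) has_vector_derivative (vector [f', g', h'] :: real^3) $ i) (at t)"
    using exhaust_3[of i] assms by (auto simp: has_real_derivative_iff_has_vector_derivative)
qed

lemma bounded_bilinear_matrix_vector_mult:
  "bounded_bilinear ((*v) :: real^'n^'m \<Rightarrow> real^'n \<Rightarrow> real^'m)"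
  unfolding bilinear_conv_bounded_bilinear[symmetric] bilinear_def
  by (auto intro!: linearI simp: matrix_vector_mult_def vec_eq_iff sum.distrib sum_distrib_left algebra_simps)

section \<open>The brackets in the rotating frame\<close>

lemma column_matrix_mult: "column i (R ** B) = (R :: real^'n^'m) *v column i B"
  by (simp add: column_def matrix_matrix_mult_def matrix_vector_mult_def vec_eq_iff)

text \<open>
  The bracket \<open>\<langle>A\<^sub>i', A\<^sub>j\<rangle> - \<langle>A\<^sub>j', A\<^sub>i\<rangle>\<close> of columns \<open>A\<^sub>i = R X\<close>, \<open>A\<^sub>j = R Y\<close>, written in the frame
  that rotates with \<open>R\<close>; derivatives are passed as separate arguments so that the form is bilinear.
\<close>
definition body_form :: "real^3 \<Rightarrow> real^3 \<Rightarrow> real^3 \<Rightarrow> real^3 \<Rightarrow> real^3 \<Rightarrow> real" where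
  "body_form w X X' Y Y' = w \<bullet> cross3 X Y + X' \<bullet> Y - Y' \<bullet> X"

lemma body_form_components:
  "body_form w (vector [x1, x2, x3]) (vector [x1', x2', x3']) (vector [y1, y2, y3]) (vector [y1', y2', y3']) =
    w $ 1 * (x2 * y3 - y2 * x3) + w $ 2 * (x3 * y1 - y3 * x1) + w $ 3 * (x1 * y2 - y1 * x2)
    + (x1' * y1 + x2' * y2 + x3' * y3) - (y1' * x1 + y2' * x2 + y3' * x3)"
  by (simp add: body_form_def inner_vec_def sum_3 cross_components)

text \<open>
  As \<open>R\<close> is orthogonal, \<open>\<langle>(R X)', R Y\<rangle> = \<langle>R\<^sup>T R' X + X', Y\<rangle>\<close>. The rotation contributes
  \<open>(w \<times> X) \<bullet> Y / 2 - (w \<times> Y) \<bullet> X / 2\<close>, a sum of two equal triple products, so the factor \<open>1/2\<close>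
  disappears.
\<close>
lemma Qform_body_frame:
  fixes A :: "real \<Rightarrow> real^'m^3"
  assumes "open I" "t \<in> I" and AB: "\<forall>s\<in>I. A s = R s ** B s"
    and rot: "rotation_matrix (R t)" and w: "has_rotation_vector R w t"
    and X: "((\<lambda>s. column i (B s)) has_vector_derivative X') (at t)"
    and Y: "((\<lambda>s. column j (B s)) has_vector_derivative Y') (at t)"
  shows "Qform A i j t = body_form w (column i (B t)) X' (column j (B t)) Y'"
proof -
  from w obtain R' where R': "(R has_vector_derivative R') (at t)"
    and RR: "\<And>x. (transpose (R t) ** R') *v x = (1/2) *\<^sub>R cross3 w x"
    unfolding has_rotation_vector_def by blast
  have orth: "transpose (R t) ** R t = mat 1"
    using rot by (simp add: rotation_matrix_def orthogonal_matrix)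
  have inner_rot: "(M *v x) \<bullet> (R t *v y) = ((transpose (R t) ** M) *v x) \<bullet> y" for M x y
    by (metis dot_lmul_matrix inner_commute matrix_vector_mul_assoc transpose_matrix_vector)
  have deriv_col: "vector_derivative (\<lambda>s. column i (A s)) (at t) = R t *v V' + R' *v column i (B t)"
    if V: "((\<lambda>s. column i (B s)) has_vector_derivative V') (at t)" for i V'
  proof (rule vector_derivative_at)
    have "((\<lambda>s. R s *v column i (B s)) has_vector_derivative R t *v V' + R' *v column i (B t)) (at t)"
      by (rule bounded_bilinear.has_vector_derivative[OF bounded_bilinear_matrix_vector_mult R' V])
    then show "((\<lambda>s. column i (A s)) has_vector_derivative R t *v V' + R' *v column i (B t)) (at t)"
      by (rule has_vector_derivative_transform_within_open[OF _ \<open>open I\<close> \<open>t \<in> I\<close>])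
        (simp add: AB column_matrix_mult)
  qed
  show ?thesis
    using assms(2)
    unfolding Qform_def deriv_col[OF X] deriv_col[OF Y] body_form_def
    by (simp add: AB column_matrix_mult inner_left_distrib inner_rot RR orth)
      (simp add: cross3_simps field_simps)
qed

lemma vector_6:
  "(vector [a,b,c,d,e,f] :: ('a::zero)^6) $ 1 = a"
  "(vector [a,b,c,d,e,f] :: ('a::zero)^6) $ 2 = b"
  "(vector [a,b,c,d,e,f] :: ('a::zero)^6) $ 3 = c"
  "(vector [a,b,c,d,e,f] :: ('a::zero)^6) $ 4 = d"
  "(vector [a,b,c,d,e,f] :: ('a::zero)^6) $ 5 = e"
  "(vector [a,b,c,d,e,f] :: ('a::zero)^6) $ 6 = f"
  unfolding vector_def by simp_all

lemma exhaust_6: "x = 1 \<or> x = 2 \<or> x = 3 \<or> x = 4 \<or> x = 5 \<or> x = 6" for x :: 6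
proof (induct x)
  case (of_int z)
  then have "z = 0 \<or> z = 1 \<or> z = 2 \<or> z = 3 \<or> z = 4 \<or> z = 5" by fastforce
  then show ?case by auto
qed

lemma forall_6: "(\<forall>i::6. P i) \<longleftrightarrow> P 1 \<and> P 2 \<and> P 3 \<and> P 4 \<and> P 5 \<and> P 6"
  by (metis exhaust_6)

lemma Bmat_nth:
  "Bmat l1 l2 b11 b12 b22 b15 b25 b35 $ 1 = vector [b11, b12, l1 * b11 + l2 * b12, - l2 * b11 + l1 * b12, l1 * b15, - l2 * b15]"
  "Bmat l1 l2 b11 b12 b22 b15 b25 b35 $ 2 = vector [0, b22, l2 * b22, l1 * b22, l1 * b25, - l2 * b25]"
  "Bmat l1 l2 b11 b12 b22 b15 b25 b35 $ 3 = vector [0, 0, 0, 0, l1 * b35, - l2 * b35]"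
  by (simp_all add: Bmat_def)

lemma column_Bmat:
  fixes l1 l2 b11 b12 b22 b15 b25 b35
  defines "B \<equiv> Bmat l1 l2 b11 b12 b22 b15 b25 b35"
    and "X \<equiv> vector [b11, 0, 0]" and "Y \<equiv> vector [b12, b22, 0]" and "Z \<equiv> vector [b15, b25, b35]"
  shows "column 1 B = X" "column 2 B = Y"
    "column 3 B = l1 *\<^sub>R X + l2 *\<^sub>R Y" "column 4 B = (-l2) *\<^sub>R X + l1 *\<^sub>R Y"
    "column 5 B = l1 *\<^sub>R Z" "column 6 B = (-l2) *\<^sub>R Z"
  unfolding assms Bmat_def
  by (simp_all add: column_def vec_eq_iff forall_3 vector_6)

text \<open>
  Only three brackets survive: those of \<open>X, Y\<close>, of \<open>X, Z\<close> and of \<open>Y, Z\<close>. All others follow from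
  bilinearity and the product rule, which adds inner products of \<open>X, Y, Z\<close> weighted by \<open>l1', l2'\<close>.
\<close>
lemma Qform_ansatz:
  fixes A :: "real \<Rightarrow> real^6^3"
  assumes I: "open I" "t \<in> I" and AB: "\<forall>s\<in>I. A s = R s ** B s"
    and rot: "rotation_matrix (R t)" "has_rotation_vector R w t"
    and col: "\<And>s. column 1 (B s) = X s" "\<And>s. column 2 (B s) = Y s"
      "\<And>s. column 3 (B s) = l1 s *\<^sub>R X s + l2 s *\<^sub>R Y s"
      "\<And>s. column 4 (B s) = (- l2 s) *\<^sub>R X s + l1 s *\<^sub>R Y s"
      "\<And>s. column 5 (B s) = l1 s *\<^sub>R Z s" "\<And>s. column 6 (B s) = (- l2 s) *\<^sub>R Z s"
    and X: "(X has_vector_derivative X') (at t)" and Y: "(Y has_vector_derivative Y') (at t)"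
    and Z: "(Z has_vector_derivative Z') (at t)"
    and l1: "(l1 has_real_derivative l1') (at t)" and l2: "(l2 has_real_derivative l2') (at t)"
  defines "q12 \<equiv> body_form w (X t) X' (Y t) Y'" and "qXZ \<equiv> body_form w (X t) X' (Z t) Z'"
    and "qYZ \<equiv> body_form w (Y t) Y' (Z t) Z'"
    and "xx \<equiv> X t \<bullet> X t" and "xy \<equiv> X t \<bullet> Y t" and "yy \<equiv> Y t \<bullet> Y t"
    and "zz \<equiv> Z t \<bullet> Z t" and "u \<equiv> X t \<bullet> Z t" and "v \<equiv> Y t \<bullet> Z t"
  shows "Qform A 1 2 t = q12"
    "Qform A 1 3 t = l2 t * q12 - l1' * xx - l2' * xy"
    "Qform A 1 4 t = l1 t * q12 + l2' * xx - l1' * xy"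
    "Qform A 2 3 t = - l1 t * q12 - l1' * xy - l2' * yy"
    "Qform A 2 4 t = l2 t * q12 + l2' * xy - l1' * yy"
    "Qform A 1 5 t - Qform A 2 6 t = l1 t * qXZ + l2 t * qYZ - l1' * u - l2' * v"
    "Qform A 1 6 t + Qform A 2 5 t = - l2 t * qXZ + l1 t * qYZ + l2' * u - l1' * v"
    "Qform A 3 5 t = l1 t * (l1 t * qXZ + l2 t * qYZ + l1' * u + l2' * v) - l1' * (l1 t * u + l2 t * v)"
    "Qform A 3 6 t = - l2 t * (l1 t * qXZ + l2 t * qYZ + l1' * u + l2' * v) + l2' * (l1 t * u + l2 t * v)"
    "Qform A 4 5 t = l1 t * (- l2 t * qXZ + l1 t * qYZ - l2' * u + l1' * v) - l1' * (- l2 t * u + l1 t * v)"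
    "Qform A 4 6 t = - l2 t * (- l2 t * qXZ + l1 t * qYZ - l2' * u + l1' * v) + l2' * (- l2 t * u + l1 t * v)"
    "Qform A 5 6 t = (l1 t * l2' - l1' * l2 t) * zz"
proof -
  have l2m: "((\<lambda>s. - l2 s) has_real_derivative - l2') (at t)"
    using l2 by (rule DERIV_minus)
  have cols: "((\<lambda>s. column 1 (B s)) has_vector_derivative X') (at t)"
    "((\<lambda>s. column 2 (B s)) has_vector_derivative Y') (at t)"
    "((\<lambda>s. column 3 (B s)) has_vector_derivative
       (l1 t *\<^sub>R X' + l1' *\<^sub>R X t) + (l2 t *\<^sub>R Y' + l2' *\<^sub>R Y t)) (at t)"
    "((\<lambda>s. column 4 (B s)) has_vector_derivative
       ((- l2 t) *\<^sub>R X' + (- l2') *\<^sub>R X t) + (l1 t *\<^sub>R Y' + l1' *\<^sub>R Y t)) (at t)"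
    "((\<lambda>s. column 5 (B s)) has_vector_derivative l1 t *\<^sub>R Z' + l1' *\<^sub>R Z t) (at t)"
    "((\<lambda>s. column 6 (B s)) has_vector_derivative (- l2 t) *\<^sub>R Z' + (- l2') *\<^sub>R Z t) (at t)"
    unfolding col
    by (intro X Y Z has_vector_derivative_add has_vector_derivative_scaleR l1 l2 l2m)+
  note Q = Qform_body_frame[OF I AB rot]
  note expand = col q12_def qXZ_def qYZ_def xx_def xy_def yy_def zz_def u_def v_def body_form_def
    cross_add_left cross_add_right cross_mult_left cross_mult_right
    Cross3.right_diff_distrib Cross3.left_diff_distrib inner_add_left inner_add_right
  show "Qform A 1 2 t = q12"
    unfolding Q[OF cols(1) cols(2)] by (simp add: col q12_def)
  show "Qform A 1 3 t = l2 t * q12 - l1' * xx - l2' * xy"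
    unfolding Q[OF cols(1) cols(3)] by (simp add: expand inner_commute algebra_simps)
  show "Qform A 1 4 t = l1 t * q12 + l2' * xx - l1' * xy"
    unfolding Q[OF cols(1) cols(4)] by (simp add: expand inner_commute algebra_simps)
  have skew: "cross3 (Y t) (X t) = - cross3 (X t) (Y t)"
    by (rule cross_skew)
  show "Qform A 2 3 t = - l1 t * q12 - l1' * xy - l2' * yy"
    unfolding Q[OF cols(2) cols(3)] by (simp add: expand skew inner_commute algebra_simps)
  show "Qform A 2 4 t = l2 t * q12 + l2' * xy - l1' * yy"
    unfolding Q[OF cols(2) cols(4)] by (simp add: expand skew inner_commute algebra_simps)
  show "Qform A 1 5 t - Qform A 2 6 t = l1 t * qXZ + l2 t * qYZ - l1' * u - l2' * v"
    unfolding Q[OF cols(1) cols(5)] Q[OF cols(2) cols(6)]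
    by (simp add: expand inner_commute algebra_simps)
  show "Qform A 1 6 t + Qform A 2 5 t = - l2 t * qXZ + l1 t * qYZ + l2' * u - l1' * v"
    unfolding Q[OF cols(1) cols(6)] Q[OF cols(2) cols(5)]
    by (simp add: expand inner_commute algebra_simps)
  show "Qform A 3 5 t = l1 t * (l1 t * qXZ + l2 t * qYZ + l1' * u + l2' * v) - l1' * (l1 t * u + l2 t * v)"
    unfolding Q[OF cols(3) cols(5)] by (simp add: expand inner_commute algebra_simps)
  show "Qform A 3 6 t = - l2 t * (l1 t * qXZ + l2 t * qYZ + l1' * u + l2' * v) + l2' * (l1 t * u + l2 t * v)"
    unfolding Q[OF cols(3) cols(6)] by (simp add: expand inner_commute algebra_simps)
  show "Qform A 4 5 t = l1 t * (- l2 t * qXZ + l1 t * qYZ - l2' * u + l1' * v) - l1' * (- l2 t * u + l1 t * v)"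
    unfolding Q[OF cols(4) cols(5)] by (simp add: expand inner_commute algebra_simps)
  show "Qform A 4 6 t = - l2 t * (- l2 t * qXZ + l1 t * qYZ - l2' * u + l1' * v) + l2' * (- l2 t * u + l1 t * v)"
    unfolding Q[OF cols(4) cols(6)] by (simp add: expand inner_commute algebra_simps)
  show "Qform A 5 6 t = (l1 t * l2' - l1' * l2 t) * zz"
    unfolding Q[OF cols(5) cols(6)] by (simp add: expand inner_commute algebra_simps)
qed

section \<open>Gram matrix and Wronskian of the first two columns\<close>

text \<open>
  On a circle an affine function that stays constant along a moving point must be critical there, so
  its gradient \<open>(\<alpha>, \<beta>)\<close> is radial and its value is plus or minus the length of the gradient.
\<close>
lemma trig_linear_const:
  fixes \<theta> :: "real \<Rightarrow> real"
  assumes "open I" "t \<in> I" and \<theta>: "(\<theta> has_real_derivative \<tau>) (at t)" "\<tau> \<noteq> 0"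
    and eq: "\<And>s. s \<in> I \<Longrightarrow> \<alpha> * cos (\<theta> s) + \<beta> * sin (\<theta> s) = \<delta>"
  shows "\<alpha>\<^sup>2 + \<beta>\<^sup>2 = \<delta>\<^sup>2"
proof -
  have "((\<lambda>s. \<alpha> * cos (\<theta> s) + \<beta> * sin (\<theta> s)) has_real_derivative
      (\<beta> * cos (\<theta> t) - \<alpha> * sin (\<theta> t)) * \<tau>) (at t)"
    by (auto intro!: derivative_eq_intros \<theta>(1) simp: algebra_simps)
  moreover have "((\<lambda>s. \<alpha> * cos (\<theta> s) + \<beta> * sin (\<theta> s)) has_real_derivative 0) (at t)"
    by (rule has_field_derivative_transform_within_open[OF DERIV_const \<open>open I\<close> \<open>t \<in> I\<close>])
      (simp add: eq)
  ultimately have "(\<beta> * cos (\<theta> t) - \<alpha> * sin (\<theta> t)) * \<tau> = 0"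
    by (rule DERIV_unique)
  then have "\<alpha> * sin (\<theta> t) = \<beta> * cos (\<theta> t)"
    using \<theta>(2) by simp
  moreover have "\<alpha>\<^sup>2 + \<beta>\<^sup>2 = \<delta>\<^sup>2 + (\<alpha> * sin (\<theta> t) - \<beta> * cos (\<theta> t))\<^sup>2"
  proof -
    have "\<alpha>\<^sup>2 + \<beta>\<^sup>2 = (\<alpha>\<^sup>2 + \<beta>\<^sup>2) * ((sin (\<theta> t))\<^sup>2 + (cos (\<theta> t))\<^sup>2)"
      by simp
    also have "\<dots> = (\<alpha> * cos (\<theta> t) + \<beta> * sin (\<theta> t))\<^sup>2 + (\<alpha> * sin (\<theta> t) - \<beta> * cos (\<theta> t))\<^sup>2"
      by (simp only: power2_eq_square) algebra
    finally show ?thesis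
      using eq[OF \<open>t \<in> I\<close>] by simp
  qed
  ultimately show ?thesis by simp
qed

text \<open>
  With \<open>s = sin \<theta>\<close>, \<open>c = cos \<theta>\<close>, the pair of equations is the vector \<open>(\<tau> xx, \<tau> xy)\<close> rotated by the
  angle \<open>\<theta>\<close>; rotating back solves it. Here \<open>xx = X \<bullet> X\<close>, \<open>xy = X \<bullet> Y\<close>, \<open>yy = Y \<bullet> Y\<close>.
\<close>
lemma gram_from_Q13_Q14:
  fixes s c :: real
  assumes "s\<^sup>2 + c\<^sup>2 = 1"
    and "c13 = s * c12 + s * \<tau> * xx - c * \<tau> * xy"
    and "c14 = (k + c) * c12 + c * \<tau> * xx + s * \<tau> * xy"
  shows "\<tau> * xx = (c14 - c12 * k) * c + c13 * s - c12"
    and "\<tau> * xy = (c14 - c12 * k) * s - c13 * c"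
  using assms by algebra+

lemma gram_from_Q23_Q24:
  fixes s c :: real
  assumes "s\<^sup>2 + c\<^sup>2 = 1"
    and "c23 = - (k + c) * c12 + s * \<tau> * xy - c * \<tau> * yy"
    and "c24 = s * c12 + c * \<tau> * xy + s * \<tau> * yy"
  shows "\<tau> * xy = (c23 + c12 * k) * s + c24 * c"
    and "\<tau> * yy = c24 * s - (c23 + c12 * k) * c - c12"
  using assms by algebra+

text \<open>
  The two Gram entries \<open>P = \<tau> b11\<^sup>2\<close> and \<open>M = \<tau> b11 b12\<close> satisfy \<open>b12 P = b11 M\<close>. Differentiating this
  relation, with \<open>P' = - \<tau> M\<close> and \<open>M' = \<tau> (P + c12)\<close>, never differentiates \<open>\<tau>\<close>, and
  \<open>(P + c12)\<^sup>2 + M\<^sup>2 = a\<^sup>2 + b\<^sup>2\<close> removes \<open>M\<close>.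
\<close>
lemma wronskian_from_gram:
  fixes b11 b12 \<theta> \<tau> :: "real \<Rightarrow> real"
  assumes "open I" "t \<in> I" and \<theta>: "(\<theta> has_real_derivative \<tau> t) (at t)"
    and b11: "(b11 has_real_derivative b11') (at t)" and b12: "(b12 has_real_derivative b12') (at t)"
    and P: "\<And>s. s \<in> I \<Longrightarrow> \<tau> s * (b11 s)\<^sup>2 = a * cos (\<theta> s) + b * sin (\<theta> s) - c12"
    and M: "\<And>s. s \<in> I \<Longrightarrow> \<tau> s * (b11 s * b12 s) = a * sin (\<theta> s) - b * cos (\<theta> s)"
  shows "\<tau> t * (b11 t)\<^sup>2 * (b11' * b12 t - b12' * b11 t) = c12\<^sup>2 - a\<^sup>2 - b\<^sup>2 + c12 * (\<tau> t * (b11 t)\<^sup>2)"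
proof -
  let ?P = "\<lambda>s. a * cos (\<theta> s) + b * sin (\<theta> s) - c12"
  let ?M = "\<lambda>s. a * sin (\<theta> s) - b * cos (\<theta> s)"
  have zero: "b12 s * ?P s - b11 s * ?M s = 0" if "s \<in> I" for s
    using P[OF that] M[OF that] by algebra
  have "((\<lambda>s. b12 s * ?P s - b11 s * ?M s) has_real_derivative
      b12' * ?P t + b12 t * (\<tau> t * - ?M t) - (b11' * ?M t + b11 t * (\<tau> t * (?P t + c12)))) (at t)"
    by (auto intro!: derivative_eq_intros \<theta> b11 b12 simp: algebra_simps)
  moreover have "((\<lambda>s. b12 s * ?P s - b11 s * ?M s) has_real_derivative 0) (at t)"
    by (rule has_field_derivative_transform_within_open[OF DERIV_const \<open>open I\<close> \<open>t \<in> I\<close>])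
      (simp add: zero)
  ultimately have D: "b12' * ?P t + b12 t * (\<tau> t * - ?M t) - (b11' * ?M t + b11 t * (\<tau> t * (?P t + c12))) = 0"
    by (rule DERIV_unique)
  have sc: "(sin (\<theta> t))\<^sup>2 + (cos (\<theta> t))\<^sup>2 = 1"
    by simp
  have PM: "(?P t + c12)\<^sup>2 + (?M t)\<^sup>2 = a\<^sup>2 + b\<^sup>2"
    using sc by algebra
  have 1: "b11 t * b12 t * (\<tau> t * ?M t) = (?M t)\<^sup>2"
    using M[OF \<open>t \<in> I\<close>] by algebra
  have 2: "b11 t * b11 t * \<tau> t = ?P t"
    using P[OF \<open>t \<in> I\<close>] by algebra
  have "?P t * (b11' * b12 t - b12' * b11 t) = - (?M t)\<^sup>2 - ?P t * (?P t + c12)"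
    using D 1 2 zero[OF \<open>t \<in> I\<close>] by algebra
  then show ?thesis
    unfolding P[OF \<open>t \<in> I\<close>] using PM by algebra
qed

section \<open>Decoupling of the last two columns\<close>

text \<open>
  Differentiating \<open>p(e\<^sup>i\<^sup>\<theta>) = 0\<close> along the motion shows that the derivative of \<open>p\<close> vanishes there too, so
  induction on the degree reduces the claim to constant polynomials.
\<close>
lemma poly_eq_0_of_moving_cis:
  fixes p :: "complex poly"
  assumes "open I" "t0 \<in> I"
    and \<theta>: "\<And>t. t \<in> I \<Longrightarrow> (\<theta> has_real_derivative \<theta>' t) (at t)"
    and nz: "\<And>t. t \<in> I \<Longrightarrow> \<theta>' t \<noteq> 0"
    and "\<And>t. t \<in> I \<Longrightarrow> poly p (cis (\<theta> t)) = 0"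
  shows "p = 0"
  using assms(5)
proof (induction "degree p" arbitrary: p rule: less_induct)
  case less
  have pderiv0: "poly (pderiv p) (cis (\<theta> t)) = 0" if t: "t \<in> I" for t
  proof -
    have "((\<lambda>x. cis (\<theta> x)) has_vector_derivative \<i> * of_real (\<theta>' t) * cis (\<theta> t)) (at t)"
      using has_derivative_cis[OF \<theta>[OF t, unfolded has_field_derivative_def]]
      by (simp add: has_vector_derivative_def scaleR_conv_of_real mult_ac)
    from field_vector_diff_chain_at[OF this poly_DERIV]
    have "((\<lambda>x. poly p (cis (\<theta> x))) has_vector_derivative
        \<i> * of_real (\<theta>' t) * cis (\<theta> t) * poly (pderiv p) (cis (\<theta> t))) (at t)"
      by (simp add: o_def)
    moreover have "((\<lambda>x. poly p (cis (\<theta> x))) has_vector_derivative 0) (at t)"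
      by (rule has_vector_derivative_transform_within_open[OF has_vector_derivative_const \<open>open I\<close> t])
        (simp add: less.prems)
    ultimately have "\<i> * of_real (\<theta>' t) * cis (\<theta> t) * poly (pderiv p) (cis (\<theta> t)) = 0"
      by (rule vector_derivative_unique_at)
    then show ?thesis
      using nz[OF t] by simp
  qed
  have "degree p = 0"
  proof (rule ccontr)
    assume pos: "degree p \<noteq> 0"
    then have "pderiv p = 0"
      by (intro less.hyps pderiv0) (auto simp: degree_pderiv)
    then show False
      using pos by (simp add: pderiv_eq_0_iff)
  qed
  then obtain a where "p = [:a:]"
    by (rule degree_eq_zeroE)
  then show "p = 0"
    using less.prems[OF \<open>t0 \<in> I\<close>] by simp
qed

text \<open>
  Complex notation pairs the equations for the columns 3 and 4. \<open>L\<close> is the conjugate of \<open>l1 + i l2\<close>,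
  \<open>L'\<close> its derivative, \<open>Z\<close> and \<open>q\<close> collect the inner products and the brackets of \<open>X, Y\<close> with the third
  vector. \<open>C1\<close>, \<open>C2\<close> are the brackets of the columns 3, 4 with the columns 5, 6 and \<open>d\<close> the two combined
  brackets of the columns 1, 2 with the columns 5, 6. The second identity is free of \<open>Z\<close> and \<open>q\<close>.
\<close>
lemma complex_elimination:
  fixes L L' S T Z q C1 C2 d l1 l2 l1' l2' :: complex
  assumes "C1 = l1 * (L * q + L' * Z) - l1' * (L * Z)"
    and "C2 = - l2 * (L * q + L' * Z) + l2' * (L * Z)"
    and "d = L * q - L' * Z"
  shows "(l1 * l2' - l1' * l2) * (L * Z) = l2 * C1 + l1 * C2"
    and "L * (l2' * C1 + l1' * C2 - (l1 * l2' - l1' * l2) * d) = 2 * L' * (l2 * C1 + l1 * C2)"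
  using assms by algebra+

text \<open>
  The relation between \<open>C1, C2, d\<close> left after the elimination, divided by \<open>\<tau>\<close> and multiplied by
  \<open>2 e\<^sup>2\<^sup>i\<^sup>\<theta>\<close>. The combinations \<open>P\<close> and \<open>N\<close> are the coefficients of positive and negative frequency:
  \<open>2 (C1 cos \<theta> - C2 sin \<theta>) = P e\<^sup>i\<^sup>\<theta> + N e\<^sup>-\<^sup>i\<^sup>\<theta>\<close>.
\<close>
lemma cubic_in_cis:
  fixes C1 C2 d P N Z q L L' :: complex and \<theta> \<tau> k :: real
  defines "l1 \<equiv> k + cos \<theta>" and "l2 \<equiv> sin \<theta>" and "l1' \<equiv> - sin \<theta> * \<tau>" and "l2' \<equiv> cos \<theta> * \<tau>"
  defines "L \<equiv> Complex l1 (- l2)" and "L' \<equiv> Complex l1' (- l2')"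
  assumes "\<tau> \<noteq> 0"
    and C1: "C1 = l1 * (L * q + L' * Z) - l1' * (L * Z)"
    and C2: "C2 = - l2 * (L * q + L' * Z) + l2' * (L * Z)"
    and d: "d = L * q - L' * Z"
  defines "P \<equiv> C1 + \<i> * C2" and "N \<equiv> C1 - \<i> * C2"
  shows "poly [:- N - k * d, 2 * of_real k * P - k * N - (2 + (of_real k)\<^sup>2) * d, 3 * (P - k * d), k * (P - k * d):] (cis \<theta>) = 0"
proof -
  define z where "z = cis \<theta>"
  define y where "y = cis (- \<theta>)"
  have zy: "z * y = 1"
    by (simp add: z_def y_def cis_mult)
  have c: "2 * of_real (cos \<theta>) = z + y" and s: "2 * \<i> * of_real (sin \<theta>) = z - y"
    by (simp_all add: z_def y_def complex_eq_iff)
  have L: "L = k + y" and L': "L' = - \<i> * \<tau> * y"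
    by (simp_all add: L_def L'_def l1_def l2_def l1'_def l2'_def y_def complex_eq_iff)
  have ii: "\<i> * \<i> = -1" by simp
  define c' s' :: complex where "c' = of_real (cos \<theta>)" and "s' = of_real (sin \<theta>)"
  have lin: "complex_of_real l1 = k + c'" "complex_of_real l2 = s'"
    "complex_of_real l1' = - s' * \<tau>" "complex_of_real l2' = c' * \<tau>"
    by (simp_all add: l1_def l2_def l1'_def l2'_def c'_def s'_def)
  have csq: "s' * s' + c' * c' = 1"
    unfolding c'_def s'_def of_real_mult[symmetric] of_real_add[symmetric]
    by (simp add: power2_eq_square[symmetric])
  have "L * (of_real l2' * C1 + of_real l1' * C2
      - (of_real l1 * of_real l2' - of_real l1' * of_real l2) * d) = 2 * L' * (of_real l2 * C1 + of_real l1 * C2)"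
    by (rule complex_elimination(2)) (use C1 C2 d in auto)
  then have "\<tau> * ((k + y) * (c' * C1 - s' * C2 - (1 + k * c') * d)) =
      \<tau> * (- 2 * \<i> * y * (s' * C1 + (k + c') * C2))"
    unfolding lin L L' using csq by algebra
  then have E: "(k + y) * (c' * C1 - s' * C2 - (1 + k * c') * d) = - 2 * \<i> * y * (s' * C1 + (k + c') * C2)"
    using \<open>\<tau> \<noteq> 0\<close> by (metis mult_left_cancel of_real_eq_0_iff)
  have PN: "2 * C1 = P + N" "2 * \<i> * C2 = P - N"
    by (simp_all add: P_def N_def)
  have cPN: "2 * (c' * C1 - s' * C2) = z * P + y * N"
    using c s ii PN unfolding c'_def[symmetric] s'_def[symmetric] by algebra
  have sPN: "2 * \<i> * (s' * C1 + c' * C2) = z * P - y * N"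
    using c s ii PN unfolding c'_def[symmetric] s'_def[symmetric] by algebra
  have "(k + y) * (z * P + y * N - (2 + k * (z + y)) * d) = - 2 * y * (z * P - y * N + k * (P - N))"
    using E cPN sPN PN c unfolding c'_def[symmetric] by algebra
  then have "- N - k * d + z * (2 * of_real k * P - k * N - (2 + (of_real k)\<^sup>2) * d + z * (3 * (P - k * d) + z * (k * (P - k * d)))) = 0"
    using zy by algebra
  then show ?thesis
    by (simp add: z_def algebra_simps)
qed

text \<open>
  The coefficients of degree 0 and 2 express \<open>N\<close> and \<open>P\<close> by \<open>d\<close>; the coefficient of degree 1 becomes
  \<open>2 (k\<^sup>2 - 1) d\<close>. For \<open>k = 1\<close> the circle of \<open>(l1, l2)\<close> passes through the origin.
\<close>
lemma cubic_coefficients_eq_0: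
  fixes k :: real and P N d :: complex
  assumes "[:- N - k * d, 2 * of_real k * P - k * N - (2 + (of_real k)\<^sup>2) * d, 3 * (P - k * d), k * (P - k * d):] = 0"
    and "k\<^sup>2 \<noteq> 1"
  shows "P = 0" "N = 0" "d = 0"
proof -
  have "3 * (P - k * d) = 0" and "- N - k * d = 0" and M: "2 * of_real k * P - k * N - (2 + (of_real k)\<^sup>2) * d = 0"
    using assms(1) by (simp_all only: pCons_eq_0_iff)
  then have P: "P = k * d" and N: "N = - of_real k * d"
    by algebra+
  have "(of_real (k\<^sup>2) - 1) * d = 0"
    using M unfolding P N by (simp add: algebra_simps power2_eq_square)
  moreover have "complex_of_real (k\<^sup>2) \<noteq> 1"
    using assms(2) by (metis of_real_eq_1_iff)
  ultimately show "d = 0" by simp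
  then show "P = 0" "N = 0" using P N by simp_all
qed

text \<open>
  All six constants vanish, and the equations become homogeneous in \<open>(u, v)\<close> and \<open>(qX, qY)\<close> with the
  non-zero determinants \<open>l1 l2' - l1' l2 = \<tau> (k cos \<theta> + 1)\<close> and \<open>l1\<^sup>2 + l2\<^sup>2\<close>. In the application \<open>u, v\<close> are
  the inner products and \<open>qX, qY\<close> the brackets of \<open>X, Y\<close> with \<open>Z\<close>.
\<close>
lemma third_column_decouples:
  fixes u v qX qY \<theta> \<tau> :: "real \<Rightarrow> real"
  assumes "open I" "t0 \<in> I" and "k\<^sup>2 \<noteq> 1"
    and \<theta>: "\<And>t. t \<in> I \<Longrightarrow> (\<theta> has_real_derivative \<tau> t) (at t)"
    and nz: "\<And>t. t \<in> I \<Longrightarrow> \<tau> t \<noteq> 0" "\<And>t. t \<in> I \<Longrightarrow> k * cos (\<theta> t) + 1 \<noteq> 0"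
  defines "l1 \<equiv> \<lambda>t. k + cos (\<theta> t)" and "l2 \<equiv> \<lambda>t. sin (\<theta> t)"
    and "l1' \<equiv> \<lambda>t. - sin (\<theta> t) * \<tau> t" and "l2' \<equiv> \<lambda>t. cos (\<theta> t) * \<tau> t"
  assumes d: "\<And>t. t \<in> I \<Longrightarrow> d1 = l1 t * qX t + l2 t * qY t - l1' t * u t - l2' t * v t"
      "\<And>t. t \<in> I \<Longrightarrow> d2 = - l2 t * qX t + l1 t * qY t + l2' t * u t - l1' t * v t"
    and c: "\<And>t. t \<in> I \<Longrightarrow> c35 = l1 t * (l1 t * qX t + l2 t * qY t + l1' t * u t + l2' t * v t)
        - l1' t * (l1 t * u t + l2 t * v t)"
      "\<And>t. t \<in> I \<Longrightarrow> c36 = - l2 t * (l1 t * qX t + l2 t * qY t + l1' t * u t + l2' t * v t)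
        + l2' t * (l1 t * u t + l2 t * v t)"
      "\<And>t. t \<in> I \<Longrightarrow> c45 = l1 t * (- l2 t * qX t + l1 t * qY t - l2' t * u t + l1' t * v t)
        - l1' t * (- l2 t * u t + l1 t * v t)"
      "\<And>t. t \<in> I \<Longrightarrow> c46 = - l2 t * (- l2 t * qX t + l1 t * qY t - l2' t * u t + l1' t * v t)
        + l2' t * (- l2 t * u t + l1 t * v t)"
    and t: "t \<in> I"
  shows "u t = 0" "v t = 0" "qX t = 0" "qY t = 0"
proof -
  define C1 C2 e P N where "C1 = Complex c35 c45" and "C2 = Complex c36 c46" and "e = Complex d1 d2"
    and "P = C1 + \<i> * C2" and "N = C1 - \<i> * C2"
  define L L' Z q where "L s = Complex (l1 s) (- l2 s)" and "L' s = Complex (l1' s) (- l2' s)"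
    and "Z s = Complex (u s) (v s)" and "q s = Complex (qX s) (qY s)" for s
  have C1: "C1 = of_real (l1 s) * (L s * q s + L' s * Z s) - of_real (l1' s) * (L s * Z s)"
    and C2: "C2 = - of_real (l2 s) * (L s * q s + L' s * Z s) + of_real (l2' s) * (L s * Z s)"
    and e: "e = L s * q s - L' s * Z s" if "s \<in> I" for s
    using c[OF that] d[OF that]
    by (auto simp: C1_def C2_def e_def L_def L'_def Z_def q_def complex_eq_iff algebra_simps)
  have "[:- N - k * e, 2 * of_real k * P - k * N - (2 + (of_real k)\<^sup>2) * e, 3 * (P - k * e), k * (P - k * e):] = 0"
  proof (rule poly_eq_0_of_moving_cis[OF \<open>open I\<close> \<open>t0 \<in> I\<close> \<theta> nz(1)])
    fix s assume "s \<in> I"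
    show "poly [:- N - k * e, 2 * of_real k * P - k * N - (2 + (of_real k)\<^sup>2) * e,
        3 * (P - k * e), k * (P - k * e):] (cis (\<theta> s)) = 0"
      unfolding P_def N_def
      by (rule cubic_in_cis[OF nz(1)[OF \<open>s \<in> I\<close>], where q = "q s" and Z = "Z s"])
        (use C1[OF \<open>s \<in> I\<close>] C2[OF \<open>s \<in> I\<close>] e[OF \<open>s \<in> I\<close>] in
          \<open>simp_all add: l1_def l2_def l1'_def l2'_def L_def L'_def\<close>)
  qed
  note zero = cubic_coefficients_eq_0[OF this \<open>k\<^sup>2 \<noteq> 1\<close>]
  have "C1 = (P + N) / 2" and "\<i> * C2 = (P - N) / 2"
    by (simp_all add: P_def N_def)
  then have C0: "C1 = 0" "C2 = 0"
    using zero by simp_all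
  have "l1 t * l2' t - l1' t * l2 t = \<tau> t * (k * cos (\<theta> t) + ((sin (\<theta> t))\<^sup>2 + (cos (\<theta> t))\<^sup>2))"
    unfolding l1_def l2_def l1'_def l2'_def by algebra
  then have D: "l1 t * l2' t - l1' t * l2 t \<noteq> 0"
    using nz t by simp
  have L: "L t \<noteq> 0"
  proof
    assume "L t = 0"
    then have "l1 t = 0" "l2 t = 0" by (simp_all add: L_def complex_eq_iff)
    then show False using D by simp
  qed
  have "(of_real (l1 t) * of_real (l2' t) - of_real (l1' t) * of_real (l2 t)) * (L t * Z t) = 0"
    using complex_elimination(1)[OF C1 C2 e, OF t t t] C0 by simp
  then have "complex_of_real (l1 t * l2' t - l1' t * l2 t) * (L t * Z t) = 0"
    by simp
  then have Z0: "Z t = 0"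
    using D L by (metis mult_eq_0_iff of_real_eq_0_iff)
  then have "q t = 0"
    using e[OF t] zero(3) L by simp
  with Z0 show "u t = 0" "v t = 0" "qX t = 0" "qY t = 0"
    by (simp_all add: Z_def q_def complex_eq_iff)
qed

section \<open>Regularity of algebraic and differential relations\<close>

text \<open>
  Existence of \<open>n\<close> successive derivatives on \<open>I\<close>. Smoothness itself asks for the whole sequence at once;
  this graded version is what a bootstrapping argument by induction on \<open>n\<close> can use.
\<close>
primrec times_differentiable :: "nat \<Rightarrow> real set \<Rightarrow> (real \<Rightarrow> 'a::real_normed_vector) \<Rightarrow> bool" where
  "times_differentiable 0 I f \<longleftrightarrow> True"
| "times_differentiable (Suc n) I f \<longleftrightarrow>
     (\<exists>f'. (\<forall>t\<in>I. (f has_vector_derivative f' t) (at t)) \<and> times_differentiable n I f')"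

lemma times_differentiable_SucI:
  assumes "\<And>t. t \<in> I \<Longrightarrow> (f has_vector_derivative f' t) (at t)" and "times_differentiable n I f'"
  shows "times_differentiable (Suc n) I f"
  using assms by auto

lemma times_differentiable_Suc_imp: "times_differentiable (Suc n) I f \<Longrightarrow> times_differentiable n I f"
proof (induction n arbitrary: f)
  case (Suc n)
  from Suc.prems obtain f' where "\<forall>t\<in>I. (f has_vector_derivative f' t) (at t)"
    and "times_differentiable (Suc n) I f'"
    unfolding times_differentiable.simps(2)[of "Suc n"] by blast
  with Suc.IH[of f'] show ?case by auto
qed simp

lemma times_differentiable_cong:
  assumes "open I" and "times_differentiable n I f" and "\<And>t. t \<in> I \<Longrightarrow> f t = g t"
  shows "times_differentiable n I g"
proof (cases n)
  case (Suc m)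
  then obtain f' where f': "\<forall>t\<in>I. (f has_vector_derivative f' t) (at t)" and "times_differentiable m I f'"
    using assms(2) by auto
  moreover have "(g has_vector_derivative f' t) (at t)" if "t \<in> I" for t
    using has_vector_derivative_transform_within_open[of f "f' t" t I g] f' that assms(1,3) by blast
  ultimately show ?thesis
    unfolding Suc by (intro times_differentiable_SucI)
qed simp

text \<open>
  Derivatives at interior points are unique, so the chains of derivatives of different lengths agree
  on \<open>I\<close> and are all given by iterating the derivative operator.
\<close>
lemma smooth_onI:
  assumes "open I" and "\<And>n. times_differentiable n I f"
  shows "smooth_on I f"
proof -
  define d where "d = (\<lambda>(g :: real \<Rightarrow> 'a) t. vector_derivative g (at t))"
  have d: "(\<forall>t\<in>I. (g has_vector_derivative d g t) (at t)) \<and> (\<forall>n. times_differentiable n I (d g))"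
    if g: "\<forall>n. times_differentiable n I g" for g
  proof (intro conjI ballI allI)
    have *: "(g has_vector_derivative d g t) (at t)" if "t \<in> I" for t
    proof -
      have "times_differentiable (Suc 0) I g" using g by blast
      then show ?thesis
        using that by (auto simp: d_def vector_derivative_at)
    qed
    show "(g has_vector_derivative d g t) (at t)" if "t \<in> I" for t
      using *[OF that] .
    show "times_differentiable n I (d g)" for n
    proof -
      have "times_differentiable (Suc n) I g" using g by blast
      then obtain g' where g': "\<forall>t\<in>I. (g has_vector_derivative g' t) (at t)" "times_differentiable n I g'"
        by auto
      have "g' t = d g t" if "t \<in> I" for t
        using g'(1) *[OF that] that by (blast intro: vector_derivative_unique_at)
      from times_differentiable_cong[OF \<open>open I\<close> g'(2) this] show ?thesis .
    qed
  qed
  have all: "\<forall>n. times_differentiable n I ((d ^^ m) f)" for m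
    by (induction m) (use assms(2) d in auto)
  show ?thesis
    unfolding smooth_on_def
    by (rule exI[of _ "\<lambda>m. (d ^^ m) f"]) (use all d in auto)
qed

lemma times_differentiable_const: "times_differentiable n I (\<lambda>t. c)"
  by (induction n arbitrary: c) (auto intro!: exI[of _ "\<lambda>_. 0"])

lemma times_differentiable_add:
  "times_differentiable n I f \<Longrightarrow> times_differentiable n I g \<Longrightarrow> times_differentiable n I (\<lambda>t. f t + g t)"
proof (induction n arbitrary: f g)
  case (Suc n)
  then obtain f' g' where
    "\<forall>t\<in>I. (f has_vector_derivative f' t) (at t)" "times_differentiable n I f'"
    "\<forall>t\<in>I. (g has_vector_derivative g' t) (at t)" "times_differentiable n I g'"
    by auto
  with Suc.IH show ?case
    by (intro times_differentiable_SucI[where f' = "\<lambda>t. f' t + g' t"]) (auto intro: has_vector_derivative_add)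
qed simp

lemma times_differentiable_bilinear:
  assumes "bounded_bilinear op"
  shows "times_differentiable n I f \<Longrightarrow> times_differentiable n I g \<Longrightarrow> times_differentiable n I (\<lambda>t. op (f t) (g t))"
proof (induction n arbitrary: f g)
  case (Suc n)
  then obtain f' g' where
    f': "\<forall>t\<in>I. (f has_vector_derivative f' t) (at t)" "times_differentiable n I f'" and
    g': "\<forall>t\<in>I. (g has_vector_derivative g' t) (at t)" "times_differentiable n I g'"
    by auto
  show ?case
  proof (rule times_differentiable_SucI)
    show "((\<lambda>t. op (f t) (g t)) has_vector_derivative op (f t) (g' t) + op (f' t) (g t)) (at t)"
      if "t \<in> I" for t
      using bounded_bilinear.has_vector_derivative[OF assms] f' g' that by blast
    show "times_differentiable n I (\<lambda>t. op (f t) (g' t) + op (f' t) (g t))"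
      using Suc.prems[THEN times_differentiable_Suc_imp] f' g'
      by (intro times_differentiable_add Suc.IH)
  qed
qed simp

lemmas times_differentiable_mult = times_differentiable_bilinear[OF bounded_bilinear_mult]
lemmas times_differentiable_matrix_mult = times_differentiable_bilinear[OF bounded_bilinear_matrix_mult]
lemmas times_differentiable_scaleR = times_differentiable_bilinear[OF bounded_bilinear_scaleR]

lemma times_differentiable_vec:
  fixes f :: "real \<Rightarrow> ('a::real_normed_vector)^'n"
  shows "(\<And>i. times_differentiable n I (\<lambda>t. f t $ i)) \<Longrightarrow> times_differentiable n I f"
proof (induction n arbitrary: f)
  case (Suc n)
  from Suc.prems have "\<forall>i. \<exists>f'. (\<forall>t\<in>I. ((\<lambda>t. f t $ i) has_vector_derivative f' t) (at t)) \<and> times_differentiable n I f'"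
    by simp
  then obtain f' where f': "\<And>i t. t \<in> I \<Longrightarrow> ((\<lambda>t. f t $ i) has_vector_derivative f' i t) (at t)"
    "\<And>i. times_differentiable n I (f' i)"
    by metis
  show ?case
  proof (rule times_differentiable_SucI)
    show "(f has_vector_derivative (\<chi> i. f' i t)) (at t)" if "t \<in> I" for t
      using f'(1)[OF that] by (intro has_vector_derivative_vec) simp
    show "times_differentiable n I (\<lambda>t. \<chi> i. f' i t)"
      by (rule Suc.IH) (simp add: f'(2))
  qed
qed simp

lemma times_differentiable_minus:
  fixes f :: "real \<Rightarrow> real"
  shows "times_differentiable n I f \<Longrightarrow> times_differentiable n I (\<lambda>t. - f t)"
  using times_differentiable_mult[OF times_differentiable_const[of n I "-1 :: real"], of f] by simp

lemma times_differentiable_diff: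
  fixes f g :: "real \<Rightarrow> real"
  shows "times_differentiable n I f \<Longrightarrow> times_differentiable n I g \<Longrightarrow> times_differentiable n I (\<lambda>t. f t - g t)"
  using times_differentiable_add[OF _ times_differentiable_minus] by fastforce

lemma times_differentiable_power:
  fixes f :: "real \<Rightarrow> real"
  shows "times_differentiable n I f \<Longrightarrow> times_differentiable n I (\<lambda>t. f t ^ m)"
  by (induction m) (simp_all add: times_differentiable_const times_differentiable_mult)

lemma times_differentiable_sin_cos:
  fixes \<theta> :: "real \<Rightarrow> real"
  shows "times_differentiable n I \<theta> \<Longrightarrow>
    times_differentiable n I (\<lambda>t. sin (\<theta> t)) \<and> times_differentiable n I (\<lambda>t. cos (\<theta> t))"
proof (induction n)
  case (Suc n)
  then obtain \<tau> where \<tau>: "\<forall>t\<in>I. (\<theta> has_real_derivative \<tau> t) (at t)" "times_differentiable n I \<tau>"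
    by (auto simp: has_real_derivative_iff_has_vector_derivative)
  have IH: "times_differentiable n I (\<lambda>t. sin (\<theta> t))" "times_differentiable n I (\<lambda>t. cos (\<theta> t))"
    using Suc.IH times_differentiable_Suc_imp[OF Suc.prems] by blast+
  show ?case
  proof
    show "times_differentiable (Suc n) I (\<lambda>t. sin (\<theta> t))"
    proof (rule times_differentiable_SucI)
      show "((\<lambda>t. sin (\<theta> t)) has_vector_derivative cos (\<theta> t) * \<tau> t) (at t)" if "t \<in> I" for t
        unfolding has_real_derivative_iff_has_vector_derivative[symmetric]
        using \<tau>(1) that by (auto intro!: derivative_eq_intros)
      show "times_differentiable n I (\<lambda>t. cos (\<theta> t) * \<tau> t)"
        by (intro times_differentiable_mult IH \<tau>)
    qed
    show "times_differentiable (Suc n) I (\<lambda>t. cos (\<theta> t))"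
    proof (rule times_differentiable_SucI)
      show "((\<lambda>t. cos (\<theta> t)) has_vector_derivative - (sin (\<theta> t) * \<tau> t)) (at t)" if "t \<in> I" for t
        unfolding has_real_derivative_iff_has_vector_derivative[symmetric]
        using \<tau>(1) that by (auto intro!: derivative_eq_intros)
      show "times_differentiable n I (\<lambda>t. - (sin (\<theta> t) * \<tau> t))"
        by (intro times_differentiable_minus times_differentiable_mult IH \<tau>)
    qed
  qed
qed simp

lemma times_differentiable_inverse:
  fixes f :: "real \<Rightarrow> real"
  assumes nz: "\<And>t. t \<in> I \<Longrightarrow> f t \<noteq> 0"
  shows "times_differentiable n I f \<Longrightarrow> times_differentiable n I (\<lambda>t. inverse (f t))"
proof (induction n)
  case (Suc n)
  then obtain f' where f': "\<forall>t\<in>I. (f has_real_derivative f' t) (at t)" "times_differentiable n I f'"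
    by (auto simp: has_real_derivative_iff_has_vector_derivative)
  have IH: "times_differentiable n I (\<lambda>t. inverse (f t))"
    using Suc.IH times_differentiable_Suc_imp[OF Suc.prems] by blast
  show ?case
  proof (rule times_differentiable_SucI)
    show "((\<lambda>t. inverse (f t)) has_vector_derivative - (f' t * (inverse (f t) ^ 2))) (at t)" if "t \<in> I" for t
      unfolding has_real_derivative_iff_has_vector_derivative[symmetric]
      using f'(1) nz that by (auto intro!: derivative_eq_intros simp: power2_eq_square)
    show "times_differentiable n I (\<lambda>t. - (f' t * (inverse (f t) ^ 2)))"
      by (intro times_differentiable_minus times_differentiable_mult times_differentiable_power IH f')
  qed
qed simp

lemma times_differentiable_divide:
  fixes f g :: "real \<Rightarrow> real"
  assumes "\<And>t. t \<in> I \<Longrightarrow> g t \<noteq> 0"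
  shows "times_differentiable n I f \<Longrightarrow> times_differentiable n I g \<Longrightarrow> times_differentiable n I (\<lambda>t. f t / g t)"
  unfolding divide_inverse by (intro times_differentiable_mult times_differentiable_inverse assms)

text \<open>
  The factorization \<open>x\<^sup>m\<^sup>+\<^sup>1 - y\<^sup>m\<^sup>+\<^sup>1 = (x - y) D\<close> turns difference quotients of \<open>g\<close> into those of \<open>f\<close>;
  continuity of \<open>f\<close> gives the limit of \<open>D\<close>.
\<close>
lemma has_derivative_continuous_root:
  fixes f g :: "real \<Rightarrow> real"
  assumes "open I" "t \<in> I" "continuous_on I f"
    and "\<And>s. s \<in> I \<Longrightarrow> f s ^ Suc m = g s" and "f t \<noteq> 0"
    and "(g has_real_derivative g') (at t)"
  shows "(f has_real_derivative g' / (of_nat (Suc m) * f t ^ m)) (at t)"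
proof -
  define D where "D s = (\<Sum>p<Suc m. f s ^ p * f t ^ (m - p))" for s
  have D_eq: "g s - g t = (f s - f t) * D s" if "s \<in> I" for s
    using assms(4)[OF that] assms(4)[OF \<open>t \<in> I\<close>] power_diff_sumr2[of "f s" "Suc m" "f t"]
    by (simp add: D_def mult_ac)
  have Dt: "D t = of_nat (Suc m) * f t ^ m"
    by (simp add: D_def power_add[symmetric] del: sum.lessThan_Suc)
  have "isCont f t"
    using assms(1-3) by (simp add: continuous_on_eq_continuous_at)
  then have "D \<midarrow>t\<rightarrow> D t"
    unfolding D_def by (intro tendsto_intros) (auto simp: isCont_def)
  then have "(\<lambda>s. (g s - g t) / (s - t) / D s) \<midarrow>t\<rightarrow> g' / D t"
    using assms(6) \<open>f t \<noteq> 0\<close> by (intro tendsto_divide) (auto simp: has_field_derivative_iff Dt)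
  moreover have "\<forall>\<^sub>F s in at t. (g s - g t) / (s - t) / D s = (f s - f t) / (s - t)"
  proof -
    have "\<forall>\<^sub>F s in at t. s \<in> I"
      using assms(1,2) by (simp add: eventually_at_in_open')
    moreover have "\<forall>\<^sub>F s in at t. D s \<noteq> 0"
      using \<open>D \<midarrow>t\<rightarrow> D t\<close> \<open>f t \<noteq> 0\<close> by (intro tendsto_imp_eventually_ne[of D "D t"]) (auto simp: Dt)
    ultimately show ?thesis
      by eventually_elim (simp add: D_eq)
  qed
  ultimately have "(\<lambda>s. (f s - f t) / (s - t)) \<midarrow>t\<rightarrow> g' / D t"
    by (rule Lim_transform_eventually)
  then show ?thesis
    by (simp add: has_field_derivative_iff Dt)
qed

text \<open>
  The derivative \<open>g' / ((m + 1) f\<^sup>m)\<close> of the root involves \<open>f\<close> undifferentiated, so the induction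
  hypothesis for \<open>f\<close> provides the next derivative.
\<close>
lemma times_differentiable_root:
  fixes f g :: "real \<Rightarrow> real"
  assumes "open I" "continuous_on I f"
    and pow: "\<And>t. t \<in> I \<Longrightarrow> f t ^ Suc m = g t" and nz: "\<And>t. t \<in> I \<Longrightarrow> f t \<noteq> 0"
  shows "times_differentiable n I g \<Longrightarrow> times_differentiable n I f"
proof (induction n)
  case (Suc n)
  then obtain g' where g': "\<forall>t\<in>I. (g has_real_derivative g' t) (at t)" "times_differentiable n I g'"
    by (auto simp: has_real_derivative_iff_has_vector_derivative)
  have IH: "times_differentiable n I f"
    using Suc.IH times_differentiable_Suc_imp[OF Suc.prems] by blast
  show ?case
  proof (rule times_differentiable_SucI)
    show "(f has_vector_derivative g' t / (of_nat (Suc m) * f t ^ m)) (at t)" if "t \<in> I" for t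
      unfolding has_real_derivative_iff_has_vector_derivative[symmetric]
      using has_derivative_continuous_root[OF assms(1) that assms(2) pow nz[OF that]] g'(1) that by blast
    show "times_differentiable n I (\<lambda>t. g' t / (of_nat (Suc m) * f t ^ m))"
      by (intro times_differentiable_divide times_differentiable_mult times_differentiable_const
          times_differentiable_power g' IH) (simp add: nz del: of_nat_Suc)
  qed
qed simp

text \<open>
  The bootstrapping principle for differential equations: if the right-hand side is as regular as the
  solution, then the solution is smooth.
\<close>
lemma times_differentiable_bootstrap:
  assumes "\<And>t. t \<in> I \<Longrightarrow> (f has_vector_derivative f' t) (at t)"
    and "\<And>n. times_differentiable n I f \<Longrightarrow> times_differentiable n I f'"
  shows "times_differentiable n I f"
  by (induction n) (use assms times_differentiable_SucI in auto)

lemmas times_differentiable_intros =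
  times_differentiable_const times_differentiable_add times_differentiable_diff times_differentiable_minus
  times_differentiable_mult times_differentiable_power times_differentiable_divide

section \<open>The ansatz and its brackets\<close>

locale rotated_ansatz =
  fixes I :: "real set" and k \<gamma> :: real
    and R :: "real \<Rightarrow> real^3^3" and A :: "real \<Rightarrow> real^6^3" and w :: "real \<Rightarrow> real^3"
    and \<theta> l1 l2 b11 b12 b22 b15 b25 b35 :: "real \<Rightarrow> real"
  assumes open_I: "open I"
    and k: "k \<ge> 0" "k \<noteq> 1" and \<gamma>: "\<gamma> \<noteq> 0"
    and rot: "\<And>t. t \<in> I \<Longrightarrow> rotation_matrix (R t)"
    and rotvec: "\<And>t. t \<in> I \<Longrightarrow> has_rotation_vector R (w t) t"
    and l1: "\<And>t. t \<in> I \<Longrightarrow> l1 t = k + cos (\<theta> t)"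
    and l2: "\<And>t. t \<in> I \<Longrightarrow> l2 t = sin (\<theta> t)"
    and A: "\<And>t. t \<in> I \<Longrightarrow>
           A t = R t ** Bmat (l1 t) (l2 t) (b11 t) (b12 t) (b22 t) (b15 t) (b25 t) (b35 t)"
begin

abbreviation B where "B t \<equiv> Bmat (l1 t) (l2 t) (b11 t) (b12 t) (b22 t) (b15 t) (b25 t) (b35 t)"

lemma k_square: "k\<^sup>2 \<noteq> 1"
  using k by (simp add: power2_eq_1_iff)

lemma l_square: "t \<in> I \<Longrightarrow> (l1 t)\<^sup>2 + (l2 t)\<^sup>2 = k\<^sup>2 + 2 * k * cos (\<theta> t) + 1"
  using sin_cos_squared_add[of "\<theta> t"] by (simp add: l1 l2 power2_eq_square algebra_simps)

text \<open>
  The squared distance of the origin from a point of the unit circle about \<open>(k, 0)\<close>, which misses the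
  origin since \<open>k \<ge> 0\<close> and \<open>k \<noteq> 1\<close>.
\<close>
lemma l_square_pos: "k\<^sup>2 + 2 * k * cos x + 1 > 0"
proof -
  have "k\<^sup>2 + 2 * k * cos x + 1 = (k - 1)\<^sup>2 + 2 * k * (1 + cos x)"
    by (simp add: power2_eq_square algebra_simps)
  moreover have "(k - 1)\<^sup>2 > 0" using k by simp
  moreover have "2 * k * (1 + cos x) \<ge> 0"
    using k cos_ge_minus_one[of x] by (intro mult_nonneg_nonneg) linarith+
  ultimately show ?thesis by linarith
qed

text \<open>
  The twelve brackets in terms of the entries of \<open>B\<close>. \<open>qX\<close> and \<open>qY\<close> are the brackets of the first two
  columns with \<open>(b15, b25, b35)\<close>, \<open>u\<close> and \<open>v\<close> their inner products with it; \<open>m1, m2\<close> are the values of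
  \<open>l1, l2\<close>. Columns 1 to 4 enter through the first bracket, so that its constancy can be inserted.
\<close>
lemma Q_values:
  assumes t: "t \<in> I" and \<theta>: "(\<theta> has_real_derivative \<tau>) (at t)"
    and "(b11 has_real_derivative b11') (at t)" "(b12 has_real_derivative b12') (at t)"
    "(b22 has_real_derivative b22') (at t)" "(b15 has_real_derivative b15') (at t)"
    "(b25 has_real_derivative b25') (at t)" "(b35 has_real_derivative b35') (at t)"
  defines "q12 \<equiv> w t $ 3 * (b11 t * b22 t) + b11' * b12 t - b12' * b11 t"
    and "qX \<equiv> w t $ 3 * (b11 t * b25 t) - w t $ 2 * (b11 t * b35 t) + b11' * b15 t - b15' * b11 t"
    and "qY \<equiv> w t $ 1 * (b22 t * b35 t) - w t $ 2 * (b12 t * b35 t) + w t $ 3 * (b12 t * b25 t - b15 t * b22 t)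
      + b12' * b15 t + b22' * b25 t - b15' * b12 t - b25' * b22 t"
    and "xx \<equiv> (b11 t)\<^sup>2" and "xy \<equiv> b11 t * b12 t" and "yy \<equiv> (b12 t)\<^sup>2 + (b22 t)\<^sup>2"
    and "zz \<equiv> (b15 t)\<^sup>2 + (b25 t)\<^sup>2 + (b35 t)\<^sup>2"
    and "u \<equiv> b11 t * b15 t" and "v \<equiv> b12 t * b15 t + b22 t * b25 t"
    and "m1 \<equiv> k + cos (\<theta> t)" and "m2 \<equiv> sin (\<theta> t)"
    and "m1' \<equiv> - sin (\<theta> t) * \<tau>" and "m2' \<equiv> cos (\<theta> t) * \<tau>"
  shows "Qform A 1 2 t = q12"
    "Qform A 1 3 t = m2 * Qform A 1 2 t - m1' * xx - m2' * xy"
    "Qform A 1 4 t = m1 * Qform A 1 2 t + m2' * xx - m1' * xy"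
    "Qform A 2 3 t = - m1 * Qform A 1 2 t - m1' * xy - m2' * yy"
    "Qform A 2 4 t = m2 * Qform A 1 2 t + m2' * xy - m1' * yy"
    "Qform A 1 5 t - Qform A 2 6 t = m1 * qX + m2 * qY - m1' * u - m2' * v"
    "Qform A 1 6 t + Qform A 2 5 t = - m2 * qX + m1 * qY + m2' * u - m1' * v"
    "Qform A 3 5 t = m1 * (m1 * qX + m2 * qY + m1' * u + m2' * v) - m1' * (m1 * u + m2 * v)"
    "Qform A 3 6 t = - m2 * (m1 * qX + m2 * qY + m1' * u + m2' * v) + m2' * (m1 * u + m2 * v)"
    "Qform A 4 5 t = m1 * (- m2 * qX + m1 * qY - m2' * u + m1' * v) - m1' * (- m2 * u + m1 * v)"
    "Qform A 4 6 t = - m2 * (- m2 * qX + m1 * qY - m2' * u + m1' * v) + m2' * (- m2 * u + m1 * v)"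
    "Qform A 5 6 t = \<tau> * (k * cos (\<theta> t) + 1) * zz"
proof -
  define X Y Z :: "real \<Rightarrow> real^3" where "X s = vector [b11 s, 0, 0]" and "Y s = vector [b12 s, b22 s, 0]"
    and "Z s = vector [b15 s, b25 s, b35 s]" for s
  define X' Y' Z' :: "real^3" where "X' = vector [b11', 0, 0]" and "Y' = vector [b12', b22', 0]"
    and "Z' = vector [b15', b25', b35']"
  have XYZ: "(X has_vector_derivative X') (at t)" "(Y has_vector_derivative Y') (at t)"
    "(Z has_vector_derivative Z') (at t)"
    unfolding X_def Y_def Z_def X'_def Y'_def Z'_def
    by (intro has_vector_derivative_vector_3 assms DERIV_const)+
  have dl1: "(l1 has_real_derivative m1') (at t)"
    by (rule has_field_derivative_transform_within_open[OF _ open_I t, of "\<lambda>s. k + cos (\<theta> s)"])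
      (auto intro!: derivative_eq_intros \<theta> simp: l1 m1'_def)
  have dl2: "(l2 has_real_derivative m2') (at t)"
    by (rule has_field_derivative_transform_within_open[OF _ open_I t, of "\<lambda>s. sin (\<theta> s)"])
      (auto intro!: derivative_eq_intros \<theta> simp: l2 m2'_def)
  have AB: "\<forall>s\<in>I. A s = R s ** B s"
    using A by blast
  have forms: "body_form (w t) (X t) X' (Y t) Y' = q12" "body_form (w t) (X t) X' (Z t) Z' = qX"
    "body_form (w t) (Y t) Y' (Z t) Z' = qY"
    unfolding X_def Y_def Z_def X'_def Y'_def Z'_def body_form_components q12_def qX_def qY_def
    by (simp_all add: algebra_simps)
  have inners: "X t \<bullet> X t = xx" "X t \<bullet> Y t = xy" "Y t \<bullet> Y t = yy" "Z t \<bullet> Z t = zz" "X t \<bullet> Z t = u" "Y t \<bullet> Z t = v"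
    by (simp_all add: X_def Y_def Z_def inner_vec_def sum_3 power2_eq_square xx_def xy_def yy_def zz_def u_def v_def)
  have ls: "l1 t = m1" "l2 t = m2"
    by (simp_all add: l1[OF t] l2[OF t] m1_def m2_def)
  have cols: "column 1 (B s) = X s" "column 2 (B s) = Y s"
    "column 3 (B s) = l1 s *\<^sub>R X s + l2 s *\<^sub>R Y s" "column 4 (B s) = (- l2 s) *\<^sub>R X s + l1 s *\<^sub>R Y s"
    "column 5 (B s) = l1 s *\<^sub>R Z s" "column 6 (B s) = (- l2 s) *\<^sub>R Z s" for s
    unfolding X_def Y_def Z_def by (rule column_Bmat)+
  note Q = Qform_ansatz[where B = B, OF open_I t AB rot[OF t] rotvec[OF t] cols XYZ dl1 dl2,
      unfolded forms inners ls]
  have D: "m1 * m2' - m1' * m2 = \<tau> * (k * cos (\<theta> t) + 1)"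
    using sin_cos_squared_add[of "\<theta> t"] unfolding m1_def m2_def m1'_def m2'_def by algebra
  show "Qform A 1 2 t = q12"
    "Qform A 1 3 t = m2 * Qform A 1 2 t - m1' * xx - m2' * xy"
    "Qform A 1 4 t = m1 * Qform A 1 2 t + m2' * xx - m1' * xy"
    "Qform A 2 3 t = - m1 * Qform A 1 2 t - m1' * xy - m2' * yy"
    "Qform A 2 4 t = m2 * Qform A 1 2 t + m2' * xy - m1' * yy"
    "Qform A 1 5 t - Qform A 2 6 t = m1 * qX + m2 * qY - m1' * u - m2' * v"
    "Qform A 1 6 t + Qform A 2 5 t = - m2 * qX + m1 * qY + m2' * u - m1' * v"
    "Qform A 3 5 t = m1 * (m1 * qX + m2 * qY + m1' * u + m2' * v) - m1' * (m1 * u + m2 * v)"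
    "Qform A 3 6 t = - m2 * (m1 * qX + m2 * qY + m1' * u + m2' * v) + m2' * (m1 * u + m2 * v)"
    "Qform A 4 5 t = m1 * (- m2 * qX + m1 * qY - m2' * u + m1' * v) - m1' * (- m2 * u + m1 * v)"
    "Qform A 4 6 t = - m2 * (- m2 * qX + m1 * qY - m2' * u + m1' * v) + m2' * (- m2 * u + m1 * v)"
    unfolding Q(1) by (rule refl Q)+
  show "Qform A 5 6 t = \<tau> * (k * cos (\<theta> t) + 1) * zz"
    using Q(12) unfolding D .
qed

text \<open>Orthogonality gives \<open>B = R\<^sup>T A\<close>, so \<open>B\<close> inherits differentiability from \<open>R\<close> and \<open>A\<close>.\<close>
lemma B_entry_derivative:
  assumes "smooth_on I R" "smooth_on I A" "t \<in> I"
  shows "\<exists>D. ((\<lambda>s. B s $ i $ j) has_real_derivative D) (at t)"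
proof -
  from assms obtain R' A' where R': "(R has_vector_derivative R') (at t)"
    and A': "(A has_vector_derivative A') (at t)"
    unfolding smooth_on_def by metis
  have "((\<lambda>s. transpose (R s)) has_vector_derivative transpose R') (at t)"
    by (intro has_vector_derivative_vec)
      (simp add: transpose_def has_vector_derivative_vec_nth[OF has_vector_derivative_vec_nth[OF R']])
  from bounded_bilinear.has_vector_derivative[OF bounded_bilinear_matrix_mult this A']
  obtain B' where "((\<lambda>s. transpose (R s) ** A s) has_vector_derivative B') (at t)"
    by blast
  moreover have "transpose (R s) ** A s = B s" if "s \<in> I" for s
    using rot[OF that] unfolding A[OF that] matrix_mul_assoc
    by (simp add: rotation_matrix_def orthogonal_matrix)
  ultimately have "(B has_vector_derivative B') (at t)"
    using has_vector_derivative_transform_within_open[of "\<lambda>s. transpose (R s) ** A s" B' t I B] open_I \<open>t \<in> I\<close>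
    by blast
  from has_vector_derivative_vec_nth[OF has_vector_derivative_vec_nth[OF this]]
  show ?thesis
    unfolding has_real_derivative_iff_has_vector_derivative by blast
qed

text \<open>
  The entries \<open>b15, b25, b35\<close> occur in \<open>B\<close> only as products \<open>l1 f\<close> and \<open>- l2 f\<close>. They are recovered as
  \<open>f = (l1 (l1 f) - l2 (- l2 f)) / (l1\<^sup>2 + l2\<^sup>2)\<close>.
\<close>
lemma entry_derivatives:
  assumes "smooth_on I R" "smooth_on I A" and t: "t \<in> I" and \<theta>: "(\<theta> has_real_derivative \<tau>) (at t)"
  shows "(b11 has_real_derivative deriv b11 t) (at t)" "(b12 has_real_derivative deriv b12 t) (at t)"
    "(b22 has_real_derivative deriv b22 t) (at t)" "(b15 has_real_derivative deriv b15 t) (at t)"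
    "(b25 has_real_derivative deriv b25 t) (at t)" "(b35 has_real_derivative deriv b35 t) (at t)"
proof -
  note entry = B_entry_derivative[OF assms(1-3)]
  have first: "(f has_real_derivative deriv f t) (at t)" if "\<And>s. f s = B s $ i $ j" for f i j
    using entry[of i j] unfolding that[symmetric] by (metis DERIV_imp_deriv)
  show "(b11 has_real_derivative deriv b11 t) (at t)"
    by (rule first[of _ 1 1]) (simp add: Bmat_nth vector_6)
  show "(b12 has_real_derivative deriv b12 t) (at t)"
    by (rule first[of _ 1 2]) (simp add: Bmat_nth vector_6)
  show "(b22 has_real_derivative deriv b22 t) (at t)"
    by (rule first[of _ 2 2]) (simp add: Bmat_nth vector_6)
  have last: "(f has_real_derivative deriv f t) (at t)"
    if f: "\<And>s. B s $ i $ 5 = l1 s * f s" "\<And>s. B s $ i $ 6 = - l2 s * f s" for f i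
  proof -
    obtain D5 D6 where D5: "((\<lambda>s. l1 s * f s) has_real_derivative D5) (at t)"
      and D6: "((\<lambda>s. - l2 s * f s) has_real_derivative D6) (at t)"
      using entry[of i 5] entry[of i 6] unfolding f by blast
    define p q where "p s = l1 s * f s" and "q s = - l2 s * f s" for s
    let ?n = "\<lambda>s. k\<^sup>2 + 2 * k * cos (\<theta> s) + 1"
    let ?h = "\<lambda>s. ((k + cos (\<theta> s)) * p s - sin (\<theta> s) * q s) / ?n s"
    have "\<exists>D. (?h has_real_derivative D) (at t)"
      using l_square_pos[of "\<theta> t"]
      by (auto intro!: exI derivative_eq_intros D5[folded p_def] D6[folded q_def] \<theta>)
    then have "?h field_differentiable at t"
      by (simp add: field_differentiable_def)
    then have "(?h has_real_derivative deriv ?h t) (at t)"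
      by (simp add: DERIV_deriv_iff_field_differentiable)
    then have df: "(f has_real_derivative deriv ?h t) (at t)"
    proof (rule has_field_derivative_transform_within_open[OF _ open_I t])
      fix s assume s: "s \<in> I"
      have "(k + cos (\<theta> s)) * p s - sin (\<theta> s) * q s = ?n s * f s"
        unfolding p_def q_def using l_square[OF s] unfolding l1[OF s, symmetric] l2[OF s, symmetric] by algebra
      then show "?h s = f s"
        using l_square_pos[of "\<theta> s"] by simp
    qed
    show ?thesis
      using df unfolding DERIV_imp_deriv[OF df] .
  qed
  show "(b15 has_real_derivative deriv b15 t) (at t)"
    by (rule last[of 1]) (simp_all add: Bmat_nth vector_6)
  show "(b25 has_real_derivative deriv b25 t) (at t)"
    by (rule last[of 2]) (simp_all add: Bmat_nth vector_6)
  show "(b35 has_real_derivative deriv b35 t) (at t)"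
    by (rule last[of 3]) (simp_all add: Bmat_nth vector_6)
qed

section \<open>From constant brackets to the explicit formulas, and back\<close>

text \<open>
  \<open>X, Y\<close> are determined by the brackets among the columns 1 to 4. The decoupling of \<open>Z\<close> needs
  \<open>k cos \<theta> + 1 \<noteq> 0\<close>, the point where the bracket of the columns 5 and 6 enters: it equals
  \<open>\<tau> (k cos \<theta> + 1) \<bar>Z\<bar>\<^sup>2\<close> and is constant, so it could vanish only if \<open>cos \<theta>\<close> were constant.
\<close>
lemma explicit_of_admissible:
  assumes adm: "admissible I \<gamma> c R A \<theta> l1 l2 b11 b22 b35"
  shows "explicit_formulas I k \<gamma> (c 1 2) (c 1 3) (c 1 4) (c 5 6) \<theta> b11 b12 b22 b15 b25 b35 w"
proof (cases "I = {}")
  case True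
  then show ?thesis by (simp add: explicit_formulas_def)
next
  case False
  then obtain t0 where t0: "t0 \<in> I" by blast
  define \<tau> where "\<tau> = deriv \<theta>"
  from adm have smooth: "smooth_on I R" "smooth_on I A"
    and \<theta>_diff: "\<theta> differentiable_on I"
    and nondeg: "\<And>t. t \<in> I \<Longrightarrow> b11 t * b22 t * b35 t * ((l1 t)\<^sup>2 + (l2 t)\<^sup>2) + 1 = 0"
    and \<tau>_eq: "\<And>t. t \<in> I \<Longrightarrow> \<tau> t * b11 t * b22 t = \<gamma>"
    and Qc: "\<And>t. t \<in> I \<Longrightarrow> Qform A 1 2 t = c 1 2" "\<And>t. t \<in> I \<Longrightarrow> Qform A 1 3 t = c 1 3"
      "\<And>t. t \<in> I \<Longrightarrow> Qform A 1 4 t = c 1 4" "\<And>t. t \<in> I \<Longrightarrow> Qform A 2 3 t = c 2 3"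
      "\<And>t. t \<in> I \<Longrightarrow> Qform A 2 4 t = c 2 4" "\<And>t. t \<in> I \<Longrightarrow> Qform A 3 5 t = c 3 5"
      "\<And>t. t \<in> I \<Longrightarrow> Qform A 3 6 t = c 3 6" "\<And>t. t \<in> I \<Longrightarrow> Qform A 4 5 t = c 4 5"
      "\<And>t. t \<in> I \<Longrightarrow> Qform A 4 6 t = c 4 6" "\<And>t. t \<in> I \<Longrightarrow> Qform A 5 6 t = c 5 6"
    unfolding admissible_def \<tau>_def by auto
  from adm obtain d1 d2 where Qd: "\<And>t. t \<in> I \<Longrightarrow> Qform A 1 5 t - Qform A 2 6 t = d1"
    "\<And>t. t \<in> I \<Longrightarrow> Qform A 1 6 t + Qform A 2 5 t = d2"
    unfolding admissible_def by blast
  have \<theta>: "(\<theta> has_real_derivative \<tau> t) (at t)" if "t \<in> I" for t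
    using \<theta>_diff that open_I unfolding \<tau>_def
    by (simp add: DERIV_deriv_iff_real_differentiable differentiable_on_eq_differentiable_at)
  have nz: "\<tau> t \<noteq> 0" "b11 t \<noteq> 0" "b22 t \<noteq> 0" "b35 t \<noteq> 0" if "t \<in> I" for t
    using \<tau>_eq[OF that] nondeg[OF that] \<gamma> by auto
  note Q = Q_values[OF _ \<theta> entry_derivatives[OF smooth _ \<theta>]]
  define a where "a = c 1 4 - c 1 2 * k"
  have gram1: "\<tau> t * (b11 t)\<^sup>2 = a * cos (\<theta> t) + c 1 3 * sin (\<theta> t) - c 1 2"
    "\<tau> t * (b11 t * b12 t) = a * sin (\<theta> t) - c 1 3 * cos (\<theta> t)"
    and gram2: "\<tau> t * (b11 t * b12 t) = (c 2 3 + c 1 2 * k) * sin (\<theta> t) + c 2 4 * cos (\<theta> t)"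
    "\<tau> t * ((b12 t)\<^sup>2 + (b22 t)\<^sup>2) = c 2 4 * sin (\<theta> t) - (c 2 3 + c 1 2 * k) * cos (\<theta> t) - c 1 2"
    if t: "t \<in> I" for t
  proof -
    note Qt = Q(2-5)[OF t, unfolded Qc[OF t]]
    have "c 1 3 = sin (\<theta> t) * c 1 2 + sin (\<theta> t) * \<tau> t * (b11 t)\<^sup>2 - cos (\<theta> t) * \<tau> t * (b11 t * b12 t)"
      "c 1 4 = (k + cos (\<theta> t)) * c 1 2 + cos (\<theta> t) * \<tau> t * (b11 t)\<^sup>2 + sin (\<theta> t) * \<tau> t * (b11 t * b12 t)"
      using Qt(1,2) t by simp_all
    from gram_from_Q13_Q14[OF sin_cos_squared_add this]
    show "\<tau> t * (b11 t)\<^sup>2 = a * cos (\<theta> t) + c 1 3 * sin (\<theta> t) - c 1 2"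
      "\<tau> t * (b11 t * b12 t) = a * sin (\<theta> t) - c 1 3 * cos (\<theta> t)"
      unfolding a_def .
    have "c 2 3 = - (k + cos (\<theta> t)) * c 1 2 + sin (\<theta> t) * \<tau> t * (b11 t * b12 t)
        - cos (\<theta> t) * \<tau> t * ((b12 t)\<^sup>2 + (b22 t)\<^sup>2)"
      "c 2 4 = sin (\<theta> t) * c 1 2 + cos (\<theta> t) * \<tau> t * (b11 t * b12 t)
        + sin (\<theta> t) * \<tau> t * ((b12 t)\<^sup>2 + (b22 t)\<^sup>2)"
      using Qt(3,4) t by simp_all
    from gram_from_Q23_Q24[OF sin_cos_squared_add this]
    show "\<tau> t * (b11 t * b12 t) = (c 2 3 + c 1 2 * k) * sin (\<theta> t) + c 2 4 * cos (\<theta> t)"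
      "\<tau> t * ((b12 t)\<^sup>2 + (b22 t)\<^sup>2) = c 2 4 * sin (\<theta> t) - (c 2 3 + c 1 2 * k) * cos (\<theta> t) - c 1 2" .
  qed
  \<comment> \<open>The two expressions for the inner product of the first two columns agree along the motion.\<close>
  have "(c 2 4 + c 1 3)\<^sup>2 + (c 2 3 + c 1 2 * k - a)\<^sup>2 = 0\<^sup>2"
    by (rule trig_linear_const[OF open_I t0 \<theta>[OF t0] nz(1)[OF t0]])
      (use gram1(2) gram2(1) in \<open>simp add: algebra_simps\<close>)
  then have c24: "c 2 4 = - c 1 3" and c23: "c 2 3 + c 1 2 * k = a"
    by (simp_all add: sum_power2_eq_zero_iff eq_neg_iff_add_eq_0)
  \<comment> \<open>The Gram determinant is the square of \<open>b11 b22 = \<gamma> / \<tau>\<close>.\<close>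
  have rel: "\<gamma>\<^sup>2 = (c 1 2)\<^sup>2 - a\<^sup>2 - (c 1 3)\<^sup>2"
    using gram1[OF t0] gram2(2)[OF t0] \<tau>_eq[OF t0] sin_cos_squared_add[of "\<theta> t0"]
    unfolding c24 c23 by algebra
  have w3: "w t $ 3 = - (\<gamma> / (b11 t)\<^sup>2)" if t: "t \<in> I" for t
  proof -
    have "\<tau> t * (b11 t)\<^sup>2 * (deriv b11 t * b12 t - deriv b12 t * b11 t)
        = (c 1 2)\<^sup>2 - a\<^sup>2 - (c 1 3)\<^sup>2 + c 1 2 * (\<tau> t * (b11 t)\<^sup>2)"
      by (rule wronskian_from_gram[OF open_I t \<theta>[OF t] entry_derivatives(1,2)[OF smooth t \<theta>[OF t]] gram1])
    moreover have "w t $ 3 * (b11 t * b22 t) + (deriv b11 t * b12 t - deriv b12 t * b11 t) = c 1 2"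
      using Q(1)[OF t] Qc(1)[OF t] t by simp
    ultimately have "\<gamma> * (w t $ 3 * (b11 t)\<^sup>2 + \<gamma>) = 0"
      using rel \<tau>_eq[OF t] by algebra
    then have "w t $ 3 * (b11 t)\<^sup>2 + \<gamma> = 0"
      using \<gamma> by simp
    then show ?thesis
      using nz(2)[OF t] by (simp add: field_simps eq_neg_iff_add_eq_0)
  qed
  have Q56: "\<tau> t * (k * cos (\<theta> t) + 1) * ((b15 t)\<^sup>2 + (b25 t)\<^sup>2 + (b35 t)\<^sup>2) = c 5 6" if t: "t \<in> I" for t
    using Q(12)[OF t] Qc(10)[OF t] t by simp
  have "c 5 6 \<noteq> 0"
  proof
    assume "c 5 6 = 0"
    have "k * cos (\<theta> t) + 0 * sin (\<theta> t) = -1" if t: "t \<in> I" for t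
    proof -
      have "(b15 t)\<^sup>2 + (b25 t)\<^sup>2 + (b35 t)\<^sup>2 > 0"
        using nz(4)[OF t] by (simp add: add_nonneg_pos)
      then show ?thesis
        using Q56[OF t] nz(1)[OF t] \<open>c 5 6 = 0\<close> by auto
    qed
    from trig_linear_const[OF open_I t0 \<theta>[OF t0] nz(1)[OF t0] this]
    show False using k_square by simp
  qed
  then have kc: "k * cos (\<theta> t) + 1 \<noteq> 0" if "t \<in> I" for t
    using Q56[OF that] by auto
  define qX where "qX t = w t $ 3 * (b11 t * b25 t) - w t $ 2 * (b11 t * b35 t) + deriv b11 t * b15 t - deriv b15 t * b11 t" for t
  define qY where "qY t = w t $ 1 * (b22 t * b35 t) - w t $ 2 * (b12 t * b35 t) + w t $ 3 * (b12 t * b25 t - b15 t * b22 t)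
      + deriv b12 t * b15 t + deriv b22 t * b25 t - deriv b15 t * b12 t - deriv b25 t * b22 t" for t
  define u where "u t = b11 t * b15 t" for t
  define v where "v t = b12 t * b15 t + b22 t * b25 t" for t
  note Q' = Q[folded qX_def qY_def u_def v_def]
  have decoupled: "u t = 0" "v t = 0" "qX t = 0" "qY t = 0" if t: "t \<in> I" for t
    by (rule third_column_decouples[OF open_I t0 k_square \<theta> nz(1) kc
      trans[OF Qd(1)[symmetric] Q'(6)] trans[OF Qd(2)[symmetric] Q'(7)]
      trans[OF Qc(6)[symmetric] Q'(8)] trans[OF Qc(7)[symmetric] Q'(9)]
      trans[OF Qc(8)[symmetric] Q'(10)] trans[OF Qc(9)[symmetric] Q'(11)] t]; assumption)+
  have b15: "b15 t = 0" if "t \<in> I" for t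
    using decoupled(1)[OF that] nz(2)[OF that] by (simp add: u_def)
  have b25: "b25 t = 0" if "t \<in> I" for t
    using decoupled(2)[OF that] nz(3)[OF that] b15[OF that] by (simp add: v_def)
  have deriv0: "deriv f t = 0" if "\<And>s. s \<in> I \<Longrightarrow> f s = 0" "t \<in> I" for f :: "real \<Rightarrow> real" and t
  proof (rule DERIV_imp_deriv)
    show "(f has_real_derivative 0) (at t)"
      by (rule has_field_derivative_transform_within_open[OF DERIV_const[of 0] open_I \<open>t \<in> I\<close>]) (simp add: that(1))
  qed
  show ?thesis
    unfolding explicit_formulas_def \<tau>_def[symmetric]
  proof (intro ballI conjI)
    fix t assume t: "t \<in> I"
    note nzt = nz[OF t] kc[OF t] \<gamma>
    have n: "k\<^sup>2 + 2 * k * cos (\<theta> t) + 1 > 0"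
      by (rule l_square_pos)
    show "k * cos (\<theta> t) + 1 \<noteq> 0" "k\<^sup>2 + 2 * k * cos (\<theta> t) + 1 \<noteq> 0" "\<tau> t \<noteq> 0" "b11 t \<noteq> 0"
      using nzt n by simp_all
    show "b15 t = 0" "b25 t = 0"
      using b15[OF t] b25[OF t] by simp_all
    have b22: "b22 t = \<gamma> / (b11 t * \<tau> t)"
      using \<tau>_eq[OF t] nzt by (simp add: field_simps)
    then show "b22 t = \<gamma> / (b11 t * \<tau> t)" .
    have "b35 t * (\<gamma> * (k\<^sup>2 + 2 * k * cos (\<theta> t) + 1)) = - \<tau> t"
      using nondeg[OF t] \<tau>_eq[OF t] unfolding l_square[OF t] by algebra
    then show b35: "b35 t = - (\<tau> t / (\<gamma> * (k\<^sup>2 + 2 * k * cos (\<theta> t) + 1)))"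
      unfolding minus_divide_left using nzt n by (subst nonzero_eq_divide_eq) auto
    have "\<tau> t * (k * cos (\<theta> t) + 1) * (b35 t)\<^sup>2 = c 5 6"
      using Q56[OF t] b15[OF t] b25[OF t] by simp
    then show "\<tau> t ^ 3 = \<gamma>\<^sup>2 * c 5 6 * (k\<^sup>2 + 2 * k * cos (\<theta> t) + 1)\<^sup>2 / (k * cos (\<theta> t) + 1)"
      unfolding b35 using nzt n
      by (simp add: power2_eq_square power3_eq_cube divide_simps) (simp add: mult_ac)
    show "(b11 t)\<^sup>2 = ((c 1 4 - c 1 2 * k) * cos (\<theta> t) + c 1 3 * sin (\<theta> t) - c 1 2) / \<tau> t"
      using gram1(1)[OF t] nzt by (simp add: a_def field_simps)
    show "b12 t = ((c 1 4 - c 1 2 * k) * sin (\<theta> t) - c 1 3 * cos (\<theta> t)) / (b11 t * \<tau> t)"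
      using gram1(2)[OF t] nzt by (simp add: a_def field_simps)
    show "w t $ 3 = - (\<gamma> / (b11 t)\<^sup>2)"
      by (rule w3[OF t])
    have q: "qX t = - w t $ 2 * (b11 t * b35 t)" "qY t = w t $ 1 * (b22 t * b35 t) - w t $ 2 * (b12 t * b35 t)"
      by (simp_all add: qX_def qY_def b15[OF t] b25[OF t] deriv0[OF b15 t] deriv0[OF b25 t])
    show w2: "w t $ 2 = 0"
      using q(1) decoupled(3)[OF t] nzt by simp
    show "w t $ 1 = 0"
      using q(2) decoupled(4)[OF t] nzt w2 by simp
  qed
qed

text \<open>
  The order of the regularity argument follows the dependence of the functions: \<open>\<theta>\<close> and \<open>\<tau>\<close> from
  their differential equation, \<open>b11\<close> as a square root, the remaining entries and \<open>w\<^sub>3\<close> as rational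
  expressions, \<open>R\<close> from its linear differential equation, and finally \<open>A = R B\<close>. Smoothness of \<open>A\<close> makes
  the bracket formulas available, and the identities for \<open>X, Y\<close> are used in the opposite direction.
\<close>
lemma admissible_of_explicit:
  assumes rel: "\<gamma>\<^sup>2 = c12\<^sup>2 - (c12 * k - c14)\<^sup>2 - c13\<^sup>2"
    and \<theta>_diff: "\<theta> differentiable_on I" and cont: "continuous_on I b11"
    and expl: "explicit_formulas I k \<gamma> c12 c13 c14 c56 \<theta> b11 b12 b22 b15 b25 b35 w"
  shows "\<exists>c. c 1 2 = c12 \<and> c 1 3 = c13 \<and> c 1 4 = c14 \<and> c 5 6 = c56 \<and>
    admissible I \<gamma> c R A \<theta> l1 l2 b11 b22 b35"
proof -
  define \<tau> where "\<tau> = deriv \<theta>"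
  define a where "a = c14 - c12 * k"
  define n where "n x = k\<^sup>2 + 2 * k * cos x + 1" for x
  have n_pos: "n x > 0" for x
    unfolding n_def by (rule l_square_pos)
  have kc: "k * cos (\<theta> t) + 1 \<noteq> 0" and \<tau>_nz: "\<tau> t \<noteq> 0" and b11_nz: "b11 t \<noteq> 0"
    and b15: "b15 t = 0" and b25: "b25 t = 0"
    and \<tau>_cube: "\<tau> t ^ 3 = \<gamma>\<^sup>2 * c56 * (n (\<theta> t))\<^sup>2 / (k * cos (\<theta> t) + 1)"
    and b35: "b35 t = - (\<tau> t / (\<gamma> * n (\<theta> t)))"
    and b11_sq: "(b11 t)\<^sup>2 = (a * cos (\<theta> t) + c13 * sin (\<theta> t) - c12) / \<tau> t"
    and b12: "b12 t = (a * sin (\<theta> t) - c13 * cos (\<theta> t)) / (b11 t * \<tau> t)"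
    and b22: "b22 t = \<gamma> / (b11 t * \<tau> t)"
    and w: "w t $ 1 = 0" "w t $ 2 = 0" "w t $ 3 = - (\<gamma> / (b11 t)\<^sup>2)"
    if "t \<in> I" for t
    using expl that unfolding explicit_formulas_def \<tau>_def a_def n_def by auto
  have \<theta>: "(\<theta> has_real_derivative \<tau> t) (at t)" if "t \<in> I" for t
    using \<theta>_diff that open_I unfolding \<tau>_def
    by (simp add: DERIV_deriv_iff_real_differentiable differentiable_on_eq_differentiable_at)

  \<comment> \<open>Real cube roots are unique, so \<open>\<tau>\<close> is the cube root of a continuous function of \<open>\<theta>\<close>.\<close>
  have \<tau>_cont: "continuous_on I \<tau>"
  proof -
    have "continuous_on I (\<lambda>t. root 3 (\<gamma>\<^sup>2 * c56 * (n (\<theta> t))\<^sup>2 / (k * cos (\<theta> t) + 1)))"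
      unfolding n_def
      by (intro continuous_intros differentiable_imp_continuous_on[OF \<theta>_diff]) (use kc in auto)
    then show ?thesis
      by (rule continuous_on_eq) (simp add: \<tau>_cube[symmetric] odd_real_root_power_cancel)
  qed
  have \<tau>_smooth: "times_differentiable m I \<tau>" if "times_differentiable m I \<theta>" for m
    by (rule times_differentiable_root[OF open_I \<tau>_cont, of 2])
      (use \<tau>_cube \<tau>_nz times_differentiable_sin_cos[OF that] kc in
        \<open>auto simp: n_def numeral_3_eq_3 numeral_2_eq_2 intro!: times_differentiable_intros\<close>)
  have \<theta>_smooth: "times_differentiable m I \<theta>" for m
    by (rule times_differentiable_bootstrap[of I \<theta> \<tau>])
      (use \<theta> \<tau>_smooth in \<open>auto simp: has_real_derivative_iff_has_vector_derivative\<close>)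
  note \<tau>_smooth = \<tau>_smooth[OF \<theta>_smooth]
  note trig_smooth = times_differentiable_sin_cos[OF \<theta>_smooth, THEN conjunct1]
    times_differentiable_sin_cos[OF \<theta>_smooth, THEN conjunct2]
  have b11_smooth: "times_differentiable m I b11" for m
    by (rule times_differentiable_root[OF open_I cont, of 1
          "\<lambda>t. (a * cos (\<theta> t) + c13 * sin (\<theta> t) - c12) / \<tau> t"])
      (use b11_sq b11_nz \<tau>_nz \<tau>_smooth trig_smooth in
        \<open>auto simp: numeral_2_eq_2 intro!: times_differentiable_intros\<close>)
  have b12_smooth: "times_differentiable m I b12" for m
    by (rule times_differentiable_cong[OF open_I, of _ "\<lambda>t. (a * sin (\<theta> t) - c13 * cos (\<theta> t)) / (b11 t * \<tau> t)"])
      (use b12 b11_nz \<tau>_nz in \<open>auto intro!: times_differentiable_intros b11_smooth \<tau>_smooth trig_smooth\<close>)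
  have b22_smooth: "times_differentiable m I b22" for m
    by (rule times_differentiable_cong[OF open_I, of _ "\<lambda>t. \<gamma> / (b11 t * \<tau> t)"])
      (use b22 b11_nz \<tau>_nz in \<open>auto intro!: times_differentiable_intros b11_smooth \<tau>_smooth\<close>)
  have b35_smooth: "times_differentiable m I b35" for m
    by (rule times_differentiable_cong[OF open_I, of _ "\<lambda>t. - (\<tau> t / (\<gamma> * n (\<theta> t)))"])
      (use b35 \<gamma> n_pos in \<open>auto simp: n_def less_le intro!: times_differentiable_intros \<tau>_smooth trig_smooth\<close>)
  have w3_smooth: "times_differentiable m I (\<lambda>t. w t $ 3)" for m
    by (rule times_differentiable_cong[OF open_I, of _ "\<lambda>t. - (\<gamma> / (b11 t)\<^sup>2)"])
      (use w b11_nz in \<open>auto intro!: times_differentiable_intros b11_smooth\<close>)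
  have l1_smooth: "times_differentiable m I l1" for m
    by (rule times_differentiable_cong[OF open_I, of _ "\<lambda>t. k + cos (\<theta> t)"])
      (use l1 in \<open>auto intro!: times_differentiable_intros trig_smooth\<close>)
  have l2_smooth: "times_differentiable m I l2" for m
    by (rule times_differentiable_cong[OF open_I, of _ "\<lambda>t. sin (\<theta> t)"])
      (use l2 in \<open>auto intro!: trig_smooth\<close>)
  have zero_smooth: "times_differentiable m I b15" "times_differentiable m I b25" for m
    by (rule times_differentiable_cong[OF open_I times_differentiable_const[of _ _ 0]]; simp add: b15 b25)+

  \<comment> \<open>\<open>R\<^sup>T R'\<close> is the matrix of \<open>x \<mapsto> w \<times> x / 2\<close>; for \<open>w\<close> along the third axis it is a multiple of \<open>J\<close>.\<close>
  define J :: "real^3^3" where "J = vector [vector [0, -1, 0], vector [1, 0, 0], vector [0, 0, 0]]"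
  have R_deriv: "(R has_vector_derivative R t ** ((w t $ 3 / 2) *\<^sub>R J)) (at t)" if t: "t \<in> I" for t
  proof -
    obtain R' where R': "(R has_vector_derivative R') (at t)"
      and RR: "\<And>x. (transpose (R t) ** R') *v x = (1/2) *\<^sub>R cross3 (w t) x"
      using rotvec[OF t] unfolding has_rotation_vector_def by blast
    have "(transpose (R t) ** R') *v x = ((w t $ 3 / 2) *\<^sub>R J) *v x" for x
      unfolding RR
      by (simp add: vec_eq_iff forall_3 cross_components w(1,2)[OF t] matrix_vector_mult_def sum_3 J_def)
    then have "transpose (R t) ** R' = (w t $ 3 / 2) *\<^sub>R J"
      by (simp add: matrix_eq)
    then have "R t ** ((w t $ 3 / 2) *\<^sub>R J) = (R t ** transpose (R t)) ** R'"
      by (simp only: matrix_mul_assoc[symmetric])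
    also have "\<dots> = R'"
      using rot[OF t] by (simp add: rotation_matrix_def orthogonal_matrix_def)
    finally show ?thesis using R' by simp
  qed
  have R_smooth: "times_differentiable m I R" for m
  proof (rule times_differentiable_bootstrap[OF R_deriv])
    fix m assume "times_differentiable m I R"
    then show "times_differentiable m I (\<lambda>t. R t ** ((w t $ 3 / 2) *\<^sub>R J))"
      by (intro times_differentiable_matrix_mult times_differentiable_scaleR)
        (auto intro!: times_differentiable_intros w3_smooth)
  qed
  have B_smooth: "times_differentiable m I B" for m
  proof (intro times_differentiable_vec)
    fix i :: 3 and j :: 6
    have "\<forall>i j. times_differentiable m I (\<lambda>t. B t $ i $ j)"
      unfolding forall_3 forall_6 Bmat_nth vector_6
      by (intro conjI times_differentiable_intros l1_smooth l2_smooth b11_smooth b12_smooth b22_smooth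
          zero_smooth b35_smooth)
    then show "times_differentiable m I (\<lambda>t. B t $ i $ j)" by blast
  qed
  have A_smooth: "times_differentiable m I A" for m
    by (rule times_differentiable_cong[OF open_I times_differentiable_matrix_mult[OF R_smooth B_smooth]])
      (simp add: A)
  have smooth: "smooth_on I R" "smooth_on I A"
    by (intro smooth_onI open_I R_smooth A_smooth)+

  \<comment> \<open>The values on columns 2 with 3, 4 are forced by the consistency of the two expressions for \<open>X \<bullet> Y\<close>.\<close>
  define c :: "6 \<Rightarrow> 6 \<Rightarrow> real" where "c i j =
    (if i = 1 \<and> j = 2 then c12 else if i = 1 \<and> j = 3 then c13 else if i = 1 \<and> j = 4 then c14
     else if i = 2 \<and> j = 3 then c14 - 2 * c12 * k else if i = 2 \<and> j = 4 then - c13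
     else if i = 5 \<and> j = 6 then c56 else 0)" for i j
  have c: "c 1 2 = c12" "c 1 3 = c13" "c 1 4 = c14" "c 2 3 = c14 - 2 * c12 * k" "c 2 4 = - c13"
    "c 3 5 = 0" "c 3 6 = 0" "c 4 5 = 0" "c 4 6 = 0" "c 5 6 = c56"
    by (simp_all add: c_def)
  have Qc: "Qform A 1 2 t = c12" "Qform A 1 3 t = c13" "Qform A 1 4 t = c14"
    "Qform A 2 3 t = c14 - 2 * c12 * k" "Qform A 2 4 t = - c13"
    "Qform A 3 5 t = 0" "Qform A 3 6 t = 0" "Qform A 4 5 t = 0" "Qform A 4 6 t = 0" "Qform A 5 6 t = c56"
    "Qform A 1 5 t - Qform A 2 6 t = 0" "Qform A 1 6 t + Qform A 2 5 t = 0"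
    if t: "t \<in> I" for t
  proof -
    have d0: "(b15 has_real_derivative 0) (at t)" "(b25 has_real_derivative 0) (at t)"
      by (rule has_field_derivative_transform_within_open[OF DERIV_const[of 0] open_I t]; simp add: b15 b25)+
    note b = entry_derivatives[OF smooth t \<theta>[OF t]]
    note Q = Q_values[OF t \<theta>[OF t] b(1-3) d0 b(6), unfolded b15[OF t] b25[OF t] w(1,2)[OF t]]
    have gram: "\<tau> s * (b11 s)\<^sup>2 = a * cos (\<theta> s) + c13 * sin (\<theta> s) - c12"
      "\<tau> s * (b11 s * b12 s) = a * sin (\<theta> s) - c13 * cos (\<theta> s)" if "s \<in> I" for s
      using b11_sq[OF that] b12[OF that] \<tau>_nz[OF that] b11_nz[OF that] by simp_all
    have det: "\<tau> t * b11 t * b22 t = \<gamma>"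
      using b22[OF t] \<tau>_nz[OF t] b11_nz[OF t] by simp
    have sc: "(sin (\<theta> t))\<^sup>2 + (cos (\<theta> t))\<^sup>2 = 1"
      by simp
    have P_nz: "\<tau> t * (b11 t)\<^sup>2 \<noteq> 0"
      using \<tau>_nz[OF t] b11_nz[OF t] by simp
    have "\<tau> t * (b11 t)\<^sup>2 * (deriv b11 t * b12 t - deriv b12 t * b11 t)
        = c12\<^sup>2 - a\<^sup>2 - c13\<^sup>2 + c12 * (\<tau> t * (b11 t)\<^sup>2)"
      by (rule wronskian_from_gram[OF open_I t \<theta>[OF t] b(1,2) gram])
    moreover have w3: "w t $ 3 * (b11 t)\<^sup>2 = - \<gamma>"
      using w(3)[OF t] b11_nz[OF t] by simp
    ultimately have "\<tau> t * (b11 t)\<^sup>2 * (w t $ 3 * (b11 t * b22 t) + deriv b11 t * b12 t - deriv b12 t * b11 t) =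
        \<tau> t * (b11 t)\<^sup>2 * c12"
      using rel det unfolding a_def by algebra
    then show Q12: "Qform A 1 2 t = c12"
      unfolding Q(1) by (rule mult_left_cancel[OF P_nz, THEN iffD1])
    \<comment> \<open>The last Gram entry comes from the Gram determinant \<open>\<gamma>\<^sup>2\<close>.\<close>
    have "\<tau> t * (b11 t)\<^sup>2 * (\<tau> t * ((b12 t)\<^sup>2 + (b22 t)\<^sup>2)) =
        \<tau> t * (b11 t)\<^sup>2 * (- (a * cos (\<theta> t)) - c13 * sin (\<theta> t) - c12)"
      using gram[OF t] det rel sc unfolding a_def by algebra
    then have yy: "\<tau> t * ((b12 t)\<^sup>2 + (b22 t)\<^sup>2) = - (a * cos (\<theta> t)) - c13 * sin (\<theta> t) - c12"
      by (rule mult_left_cancel[OF P_nz, THEN iffD1])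
    show "Qform A 1 3 t = c13" "Qform A 1 4 t = c14"
      "Qform A 2 3 t = c14 - 2 * c12 * k" "Qform A 2 4 t = - c13"
      using gram[OF t] yy sc unfolding Q(2-5) Q12 a_def by algebra+
    show "Qform A 3 5 t = 0" "Qform A 3 6 t = 0" "Qform A 4 5 t = 0" "Qform A 4 6 t = 0"
      "Qform A 1 5 t - Qform A 2 6 t = 0" "Qform A 1 6 t + Qform A 2 5 t = 0"
      unfolding Q(6-11) by simp_all
    have "Qform A 5 6 t = \<tau> t ^ 3 * (k * cos (\<theta> t) + 1) / (\<gamma>\<^sup>2 * (n (\<theta> t))\<^sup>2)"
      unfolding Q(12) b35[OF t] by (simp add: power2_eq_square power3_eq_cube mult_ac)
    also have "\<dots> = c56"
      unfolding \<tau>_cube[OF t] using kc[OF t] \<gamma> n_pos[of "\<theta> t"] by simp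
    finally show "Qform A 5 6 t = c56" .
  qed
  have "admissible I \<gamma> c R A \<theta> l1 l2 b11 b22 b35"
    unfolding admissible_def \<tau>_def[symmetric]
  proof (intro conjI)
    show "smooth_on I R" "smooth_on I A" "\<theta> differentiable_on I"
      by (fact smooth \<theta>_diff)+
    show "\<forall>t\<in>I. b11 t * b22 t * b35 t * ((l1 t)\<^sup>2 + (l2 t)\<^sup>2) + 1 = 0"
    proof
      fix t assume t: "t \<in> I"
      show "b11 t * b22 t * b35 t * ((l1 t)\<^sup>2 + (l2 t)\<^sup>2) + 1 = 0"
        unfolding l_square[OF t] n_def[symmetric] b22[OF t] b35[OF t]
        using \<gamma> \<tau>_nz[OF t] b11_nz[OF t] n_pos[of "\<theta> t"] by simp
    qed
    show "\<forall>t\<in>I. \<tau> t * b11 t * b22 t = \<gamma>"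
      using b22 \<tau>_nz b11_nz by simp
    show "\<forall>(i, j) \<in> {(1,2), (1,3), (1,4), (2,3), (2,4), (3,5), (3,6), (4,5), (4,6), (5,6)}.
        \<forall>t\<in>I. Qform A i j t = c i j"
      using c Qc by simp
    show "\<exists>d. \<forall>t\<in>I. Qform A 1 5 t - Qform A 2 6 t = d" "\<exists>d. \<forall>t\<in>I. Qform A 1 6 t + Qform A 2 5 t = d"
      using Qc(11,12) by blast+
    show "c 1 2 \<noteq> 0"
    proof
      assume "c 1 2 = 0"
      then have "\<gamma>\<^sup>2 \<le> 0"
        using rel c(1) by simp
      then show False using \<gamma> by simp
    qed
  qed
  then show ?thesis
    using c by blast
qed

end

theorem theorem7p6:
  fixes I :: "real set" and k \<gamma> :: real
    and R :: "real \<Rightarrow> real^3^3" and A :: "real \<Rightarrow> real^6^3" and w :: "real \<Rightarrow> real^3"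
    and \<theta> l1 l2 b11 b12 b22 b15 b25 b35 :: "real \<Rightarrow> real"
  assumes "open I" and "is_interval I"
    and "k \<ge> 0" and "k \<noteq> 1" and "\<gamma> \<noteq> 0"
    and "\<And>t. t \<in> I \<Longrightarrow> rotation_matrix (R t)"
    and "\<And>t. t \<in> I \<Longrightarrow> has_rotation_vector R (w t) t"
    and "\<And>t. t \<in> I \<Longrightarrow> l1 t = k + cos (\<theta> t)"
    and "\<And>t. t \<in> I \<Longrightarrow> l2 t = sin (\<theta> t)"
    and "\<And>t. t \<in> I \<Longrightarrow>
           A t = R t ** Bmat (l1 t) (l2 t) (b11 t) (b12 t) (b22 t) (b15 t) (b25 t) (b35 t)"
  shows "(\<forall>c. admissible I \<gamma> c R A \<theta> l1 l2 b11 b22 b35 \<longrightarrow>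
            explicit_formulas I k \<gamma> (c 1 2) (c 1 3) (c 1 4) (c 5 6) \<theta> b11 b12 b22 b15 b25 b35 w)
       \<and> (\<forall>c12 c13 c14 c56.
            \<gamma>\<^sup>2 = c12\<^sup>2 - (c12 * k - c14)\<^sup>2 - c13\<^sup>2 \<and> c56 \<noteq> 0 \<and>
            \<theta> differentiable_on I \<and> continuous_on I b11 \<and>
            explicit_formulas I k \<gamma> c12 c13 c14 c56 \<theta> b11 b12 b22 b15 b25 b35 w \<longrightarrow>
            (\<exists>c. c 1 2 = c12 \<and> c 1 3 = c13 \<and> c 1 4 = c14 \<and> c 5 6 = c56 \<and>
                 admissible I \<gamma> c R A \<theta> l1 l2 b11 b22 b35))"
proof -
  interpret rotated_ansatz I k \<gamma> R A w \<theta> l1 l2 b11 b12 b22 b15 b25 b35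
    by unfold_locales (use assms in auto)
  show ?thesis
    using explicit_of_admissible admissible_of_explicit by blast
qed

end
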